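(* Let $n\ge 3$ and let $\lambda>1$ be a real number. If $S^1\times S^{2n-1}\cong(\mathbb{C}^n\setminus\{0\})/\langle z\mapsto\lambda z\rangle$ is equipped with the Vaisman structure $(J_\lambda,g_\lambda)$ described in the context, then the associated Bismut connection $\nabla^b$ has holonomy group $\operatorname{Hol}^b(S^1\times S^{2n-1})=\operatorname{U}(n-1)$.
   Context: Let $\Gamma_\lambda$ be the infinite cyclic group of transformations of $\mathbb{R}^{2n}\setminus\{0\}=\mathbb{C}^n\setminus\{0\}$ generated by $x\mapsto\lambda x$. The quotient $(\mathbb{R}^{2n}\setminus\{0\})/\Gamma_\lambda$ is diffeomorphic to $S^1\times S^{2n-1}$ via the map induced by $x\mapsto\left(\exp\left(2\pi i\frac{\log|x|}{\log\lambda}\right),\frac{x}{|x|}\right)$. The metric $\frac{1}{|x|^2}\langle\cdot,\cdot\rangle$ (with $\langle\cdot,\cdot\rangle$ the Euclidean metric) and the canonical complex structure $J\partial_{x_{2i-1}}=\partial_{x_{2i}}$, $J\partial_{x_{2i}}=-\partial_{x_{2i-1}}$ on $\mathbb{R}^{2n}\setminus\{0\}$ are $\Gamma_\lambda$-invariant and induce the metric $g_\lambda$ and complex structure $J_\lambda$ on the quotient. This Hermitian structure is Vaisman: with $\omega=g_\lambda(J_\lambda\cdot,\cdot)$ one has $d\omega=\theta\wedge\omega$ for a closed $1$-form $\theta$ (the Lee form) that is parallel for the Levi-Civita connection $\nabla^g$. The Bismut connection $\nabla^b$ of a Hermitian manifold $(M,J,g)$ is the unique connection with $\nabla^b g=0$,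 $\nabla^b J=0$ and totally skew-symmetric torsion: $g(\nabla^b_XY,Z)=g(\nabla^g_XY,Z)+\tfrac12 d\omega(JX,JY,JZ)$. Its holonomy group is a subgroup of $\operatorname{U}(n)$ (up to conjugation, via a unitary basis of a tangent space); $\operatorname{U}(n-1)$ is regarded as a subgroup of $\operatorname{U}(n)$ via $B\mapsto\begin{pmatrix}1&0\\0&B\end{pmatrix}$. *)

theory Defs
  imports "HOL-Analysis.Analysis"
begin

section \<open>Smooth maps\<close>

text \<open>
  \<open>C\<^sup>\<infinity>\<close> maps on \<open>S\<close>, meant for finite-dimensional domains: the map is differentiable within \<open>S\<close>
  and every directional derivative is again smooth. It is applied to open sets and, for curves, to
  nondegenerate intervals (with one-sided derivatives at endpoints).
\<close>

coinductive smooth_on ::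
  "'a::real_normed_vector set \<Rightarrow> ('a \<Rightarrow> 'b::real_normed_vector) \<Rightarrow> bool" for S where
  "\<lbrakk>\<And>x. x \<in> S \<Longrightarrow> (f has_derivative f' x) (at x within S);
    \<And>v. smooth_on S (\<lambda>x. f' x v)\<rbrakk> \<Longrightarrow> smooth_on S f"

section \<open>The Bismut connection of a Hermitian structure on an open set\<close>

text \<open>
  On an open subset \<open>U\<close> of a vector space the vector fields are functions, a metric is
  \<open>g x u v\<close>, an almost complex structure is \<open>J x u\<close>, and a connection is given by its
  Christoffel map \<open>C x u v\<close>: \<open>\<nabla>\<^sub>X Y = DY(X) + C(X, Y)\<close>.
  Christoffel maps are normalised to be zero outside \<open>U\<close>, so that a connection on \<open>U\<close> is
  represented by exactly one function.
\<close>

definition is_connection ::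
  "'a::euclidean_space set \<Rightarrow> ('a \<Rightarrow> 'a \<Rightarrow> 'a \<Rightarrow> 'a) \<Rightarrow> bool" where
  "is_connection U C \<longleftrightarrow>
     (\<forall>x\<in>U. bilinear (C x)) \<and>
     (\<forall>u v. smooth_on U (\<lambda>x. C x u v)) \<and>
     (\<forall>x u v. x \<notin> U \<longrightarrow> C x u v = 0)"

definition cov_deriv ::
  "('a::euclidean_space \<Rightarrow> 'a \<Rightarrow> 'a \<Rightarrow> 'a) \<Rightarrow> ('a \<Rightarrow> 'a) \<Rightarrow> ('a \<Rightarrow> 'a) \<Rightarrow> 'a \<Rightarrow> 'a" where
  "cov_deriv C X Y x = frechet_derivative Y (at x) (X x) + C x (X x) (Y x)"

definition lie_bracket :: "('a::euclidean_space \<Rightarrow> 'a) \<Rightarrow> ('a \<Rightarrow> 'a) \<Rightarrow> 'a \<Rightarrow> 'a" where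
  "lie_bracket X Y x = frechet_derivative Y (at x) (X x) - frechet_derivative X (at x) (Y x)"

definition conn_torsion ::
  "('a::euclidean_space \<Rightarrow> 'a \<Rightarrow> 'a \<Rightarrow> 'a) \<Rightarrow> ('a \<Rightarrow> 'a) \<Rightarrow> ('a \<Rightarrow> 'a) \<Rightarrow> 'a \<Rightarrow> 'a" where
  "conn_torsion C X Y x = cov_deriv C X Y x - cov_deriv C Y X x - lie_bracket X Y x"

definition metric_compatible ::
  "'a::euclidean_space set \<Rightarrow> ('a \<Rightarrow> 'a \<Rightarrow> 'a \<Rightarrow> real) \<Rightarrow> ('a \<Rightarrow> 'a \<Rightarrow> 'a \<Rightarrow> 'a) \<Rightarrow> bool" where
  "metric_compatible U g C \<longleftrightarrow>
     (\<forall>X Y Z. smooth_on U X \<longrightarrow> smooth_on U Y \<longrightarrow> smooth_on U Z \<longrightarrow>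
       (\<forall>x\<in>U. frechet_derivative (\<lambda>y. g y (Y y) (Z y)) (at x) (X x)
               = g x (cov_deriv C X Y x) (Z x) + g x (Y x) (cov_deriv C X Z x)))"

definition complex_compatible ::
  "'a::euclidean_space set \<Rightarrow> ('a \<Rightarrow> 'a \<Rightarrow> 'a) \<Rightarrow> ('a \<Rightarrow> 'a \<Rightarrow> 'a \<Rightarrow> 'a) \<Rightarrow> bool" where
  "complex_compatible U J C \<longleftrightarrow>
     (\<forall>X Y. smooth_on U X \<longrightarrow> smooth_on U Y \<longrightarrow>
       (\<forall>x\<in>U. cov_deriv C X (\<lambda>y. J y (Y y)) x = J x (cov_deriv C X Y x)))"

definition skew_torsion ::
  "'a::euclidean_space set \<Rightarrow> ('a \<Rightarrow> 'a \<Rightarrow> 'a \<Rightarrow> real) \<Rightarrow> ('a \<Rightarrow> 'a \<Rightarrow> 'a \<Rightarrow> 'a) \<Rightarrow> bool" where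
  "skew_torsion U g C \<longleftrightarrow>
     (\<forall>X Y Z. smooth_on U X \<longrightarrow> smooth_on U Y \<longrightarrow> smooth_on U Z \<longrightarrow>
       (\<forall>x\<in>U. g x (conn_torsion C X Y x) (Z x) = - g x (conn_torsion C Y X x) (Z x) \<and>
               g x (conn_torsion C X Y x) (Z x) = - g x (conn_torsion C X Z x) (Y x)))"

definition is_bismut_connection ::
  "'a::euclidean_space set \<Rightarrow> ('a \<Rightarrow> 'a \<Rightarrow> 'a \<Rightarrow> real) \<Rightarrow> ('a \<Rightarrow> 'a \<Rightarrow> 'a)
     \<Rightarrow> ('a \<Rightarrow> 'a \<Rightarrow> 'a \<Rightarrow> 'a) \<Rightarrow> bool" where
  "is_bismut_connection U g J C \<longleftrightarrow>
     is_connection U C \<and> metric_compatible U g C \<and> complex_compatible U J C \<and> skew_torsion U g C"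

definition bismut_connection ::
  "'a::euclidean_space set \<Rightarrow> ('a \<Rightarrow> 'a \<Rightarrow> 'a \<Rightarrow> real) \<Rightarrow> ('a \<Rightarrow> 'a \<Rightarrow> 'a)
     \<Rightarrow> 'a \<Rightarrow> 'a \<Rightarrow> 'a \<Rightarrow> 'a" where
  "bismut_connection U g J = (THE C. is_bismut_connection U g J C)"

section \<open>The Hermitian structure on the universal cover of the Hopf manifold\<close>

text \<open>
  \<open>\<complex>\<^sup>n\<close> is \<^typ>\<open>complex^'n\<close>; its real inner product is the Euclidean metric of
  \<open>\<real>\<^sup>2\<^sup>n\<close>, with real coordinates the real and imaginary parts of the components.
\<close>

definition hopf_metric :: "complex^'n \<Rightarrow> complex^'n \<Rightarrow> complex^'n \<Rightarrow> real" where
  "hopf_metric x u v = (u \<bullet> v) / (norm x)\<^sup>2"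

definition hopf_J :: "complex^'n \<Rightarrow> complex^'n \<Rightarrow> complex^'n" where
  "hopf_J x u = \<i> *s u"

definition hopf_bismut :: "complex^'n \<Rightarrow> complex^'n \<Rightarrow> complex^'n \<Rightarrow> complex^'n" where
  "hopf_bismut = bismut_connection (- {0}) hopf_metric hopf_J"

section \<open>The Hopf manifold and its tangent bundle\<close>

text \<open>
  The Hopf manifold consists of the orbits of the group generated by \<open>x \<mapsto> lam x\<close> on
  \<open>\<complex>\<^sup>n - {0}\<close>, and its tangent bundle of the orbits of the differentials
  \<open>(x, v) \<mapsto> (lam x, lam v)\<close>. Its charts are the local inverses of \<open>hopf_proj lam\<close>. The metric,
  complex structure and Bismut connection in these charts are those of the cover: for a
  representative \<open>x\<close> of a point \<open>m\<close>, the map \<open>hopf_tproj lam x\<close> is a linear isomorphism from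
  \<open>\<complex>\<^sup>n\<close> with \<open>hopf_metric x\<close> and \<open>hopf_J x\<close> onto the tangent space at \<open>m\<close>.
\<close>

definition hopf_proj :: "real \<Rightarrow> complex^'n \<Rightarrow> (complex^'n) set" where
  "hopf_proj lam x = {(lam powi k) *\<^sub>R x | k. True}"

definition hopf_manifold :: "real \<Rightarrow> (complex^'n) set set" where
  "hopf_manifold lam = hopf_proj lam ` (- {0})"

definition hopf_tproj :: "real \<Rightarrow> complex^'n \<Rightarrow> complex^'n \<Rightarrow> ((complex^'n) \<times> (complex^'n)) set" where
  "hopf_tproj lam x v = {((lam powi k) *\<^sub>R x, (lam powi k) *\<^sub>R v) | k. True}"

definition hopf_tangent :: "real \<Rightarrow> (complex^'n) set \<Rightarrow> ((complex^'n) \<times> (complex^'n)) set set" where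
  "hopf_tangent lam m = {hopf_tproj lam x v | x v. x \<in> m}"

section \<open>Parallel transport and holonomy\<close>

text \<open>
  A curve in the quotient is smooth if it is smooth in charts, that is, if near every parameter it
  is the projection of a smooth curve \<open>\<gamma>\<close> in \<open>\<complex>\<^sup>n - {0}\<close>.
\<close>

definition hopf_smooth_curve :: "real \<Rightarrow> real \<Rightarrow> real \<Rightarrow> (real \<Rightarrow> (complex^'n) set) \<Rightarrow> bool" where
  "hopf_smooth_curve lam a b c \<longleftrightarrow>
     (\<forall>t\<in>{a..b}. \<exists>\<epsilon>>0. \<exists>\<gamma>. smooth_on ({a..b} \<inter> ball t \<epsilon>) \<gamma> \<and>
        (\<forall>s\<in>{a..b} \<inter> ball t \<epsilon>. \<gamma> s \<noteq> 0 \<and> c s = hopf_proj lam (\<gamma> s)))"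

text \<open>
  \<open>V\<close> is a vector field along \<open>c\<close> with vanishing covariant derivative: in a chart,
  \<open>v' + C(\<gamma>', v) = 0\<close> where \<open>\<gamma>\<close> and \<open>v\<close> represent \<open>c\<close> and \<open>V\<close>.
\<close>

definition hopf_parallel_on ::
  "real \<Rightarrow> real \<Rightarrow> real \<Rightarrow> (real \<Rightarrow> (complex^'n) set)
     \<Rightarrow> (real \<Rightarrow> ((complex^'n) \<times> (complex^'n)) set) \<Rightarrow> bool" where
  "hopf_parallel_on lam a b c V \<longleftrightarrow>
     (\<forall>t\<in>{a..b}. \<exists>\<epsilon>>0. \<exists>\<gamma> v. smooth_on ({a..b} \<inter> ball t \<epsilon>) \<gamma> \<and>
        (\<forall>s\<in>{a..b} \<inter> ball t \<epsilon>.
           \<gamma> s \<noteq> 0 \<and> c s = hopf_proj lam (\<gamma> s) \<and> V s = hopf_tproj lam (\<gamma> s) (v s) \<and>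
           (v has_vector_derivative
              - hopf_bismut (\<gamma> s) (vector_derivative \<gamma> (at s within {a..b} \<inter> ball t \<epsilon>)) (v s))
             (at s within {a..b} \<inter> ball t \<epsilon>)))"

definition subdivision :: "nat \<Rightarrow> (nat \<Rightarrow> real) \<Rightarrow> bool" where
  "subdivision N p \<longleftrightarrow> p 0 = 0 \<and> p N = 1 \<and> (\<forall>i<N. p i < p (Suc i))"

definition hopf_loop :: "real \<Rightarrow> (complex^'n) set \<Rightarrow> (real \<Rightarrow> (complex^'n) set) \<Rightarrow> bool" where
  "hopf_loop lam m c \<longleftrightarrow> c 0 = m \<and> c 1 = m \<and>
     (\<exists>N p. subdivision N p \<and> (\<forall>i<N. hopf_smooth_curve lam (p i) (p (Suc i)) c))"

definition hopf_parallel ::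
  "real \<Rightarrow> (real \<Rightarrow> (complex^'n) set) \<Rightarrow> (real \<Rightarrow> ((complex^'n) \<times> (complex^'n)) set) \<Rightarrow> bool" where
  "hopf_parallel lam c V \<longleftrightarrow>
     (\<exists>N p. subdivision N p \<and> (\<forall>i<N. hopf_parallel_on lam (p i) (p (Suc i)) c V))"

text \<open>
  The holonomy group at \<open>m\<close>: the maps of the tangent space at \<open>m\<close> (extended by
  \<^const>\<open>undefined\<close>) that are parallel transport along some piecewise smooth loop at \<open>m\<close>.
\<close>

definition hopf_holonomy ::
  "real \<Rightarrow> (complex^'n) set
     \<Rightarrow> (((complex^'n) \<times> (complex^'n)) set \<Rightarrow> ((complex^'n) \<times> (complex^'n)) set) set" where
  "hopf_holonomy lam m =
     {P \<in> hopf_tangent lam m \<rightarrow>\<^sub>E hopf_tangent lam m.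
        \<exists>c. hopf_loop lam m c \<and>
          (\<forall>\<xi>\<in>hopf_tangent lam m. \<exists>V. hopf_parallel lam c V \<and> V 0 = \<xi> \<and> V 1 = P \<xi>)}"

section \<open>Unitary bases and the subgroup \<open>U(n-1)\<close> of \<open>U(n)\<close>\<close>

definition unitary_basis :: "complex^'n \<Rightarrow> ('n \<Rightarrow> complex^'n) \<Rightarrow> bool" where
  "unitary_basis x e \<longleftrightarrow>
     (\<forall>i j. hopf_metric x (e i) (e j) = (if i = j then 1 else 0) \<and>
            hopf_metric x (e i) (hopf_J x (e j)) = 0)"

definition frame_map ::
  "real \<Rightarrow> complex^'n \<Rightarrow> ('n \<Rightarrow> complex^'n) \<Rightarrow> complex^'n \<Rightarrow> ((complex^'n) \<times> (complex^'n)) set" where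
  "frame_map lam x e a = hopf_tproj lam x (\<Sum>i\<in>UNIV. (a $ i) *s e i)"

text \<open>The maps of the tangent space at \<open>m\<close> whose matrix in the frame \<open>e\<close> at \<open>x \<in> m\<close> lies in \<open>G\<close>.\<close>

definition frame_group ::
  "real \<Rightarrow> (complex^'n) set \<Rightarrow> complex^'n \<Rightarrow> ('n \<Rightarrow> complex^'n) \<Rightarrow> (complex^'n^'n) set
     \<Rightarrow> (((complex^'n) \<times> (complex^'n)) set \<Rightarrow> ((complex^'n) \<times> (complex^'n)) set) set" where
  "frame_group lam m x e G =
     {P \<in> hopf_tangent lam m \<rightarrow>\<^sub>E hopf_tangent lam m.
        \<exists>A\<in>G. \<forall>a. P (frame_map lam x e a) = frame_map lam x e (A *v a)}"

definition unitary_matrix_on :: "'n set \<Rightarrow> ('n \<Rightarrow> 'n \<Rightarrow> complex) \<Rightarrow> bool" where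
  "unitary_matrix_on I B \<longleftrightarrow>
     (\<forall>j\<in>I. \<forall>k\<in>I. (\<Sum>l\<in>I. cnj (B l j) * B l k) = (if j = k then 1 else 0))"

text \<open>
  The block matrices with blocks \<open>1\<close> and \<open>B \<in> U(n-1)\<close>; \<open>i0\<close> plays the role of the first index,
  and \<open>B\<close> is indexed by the remaining \<open>n-1\<close> indices.
\<close>

definition unitary_block_subgroup :: "'n \<Rightarrow> (complex^'n^'n) set" where
  "unitary_block_subgroup i0 =
     {(\<chi> i j. if i = i0 \<and> j = i0 then 1 else if i = i0 \<or> j = i0 then 0 else B i j) | B.
        unitary_matrix_on (- {i0}) B}"

end

theory Submission
  imports Defs
begin

text \<open>
  In terms of the Hermitian product \<open>h\<close> of \<open>\<complex>\<^sup>n\<close>, the Bismut connection on the cover has the Christoffel map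
  \<open>C(u, v) = (h(v, u) x - h(x, u) v - h(v, x) u) / |x|\<^sup>2\<close> at \<open>x\<close>. The radial field is parallel and parallel
  transport is unitary, which puts the holonomy into \<open>U(n-1)\<close>. Conversely, a suitable circle through \<open>x\<close> in
  the complex plane spanned by \<open>x\<close> and some \<open>u\<close> orthogonal to \<open>x\<close> has a holonomy that fixes this plane and
  multiplies its complement by an arbitrary phase. Letting \<open>u\<close> run through an orthogonal basis gives
  \<open>\<mu>\<^sup>n\<^sup>-\<^sup>2\<close> times the identity on the complement of \<open>x\<close>, hence, as \<open>n \<ge> 3\<close>, all scalars of modulus 1.
  Combined with the circles these yield all complex reflections, which generate \<open>U(n-1)\<close>.
\<close>

section \<open>The Hermitian product\<close>

text \<open>The upper bound rests on one fact: the Hermitian pairing of any two parallel fields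
  along the same loop is constant. This makes every holonomy map an isometry of \<open>h\<close>,
  hence complex linear, and pairing with the radial field forces \<open>x\<close> to be fixed. For
  the lower bound the parallel fields are written down in closed form along circles. Working with
  \<open>h\<close> throughout is what keeps this short: its real part is the Euclidean metric and
  its imaginary part is the metric twisted by \<open>J\<close>, so one complex identity carries the
  compatibility with both.

  The quotient adds a difficulty of its own. Curves and fields on it are known only through local
  lifts, and two fields along one curve bring lifts that need not agree. Such lifts differ by a
  power of \<open>lam\<close> whose exponent is constant on connected parameter sets, and the
  connection is invariant under dilations, so one field can be moved to the lift of the other. The
  loops built for the lower bound close up already on the cover and come with a single global
  lift.\<close>

definition herm :: "complex^'n \<Rightarrow> complex^'n \<Rightarrow> complex" where
  "herm u v = (\<Sum>i\<in>UNIV. u $ i * cnj (v $ i))"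

lemma herm_smult_left: "herm (c *s u) v = c * herm u v"
  by (simp add: herm_def sum_distrib_left mult.assoc)

lemma herm_smult_right: "herm u (c *s v) = cnj c * herm u v"
  by (simp add: herm_def sum_distrib_left algebra_simps)

lemma cnj_herm: "cnj (herm u v) = herm v u"
  by (simp add: herm_def mult.commute)

lemma inner_eq_Re_herm: "u \<bullet> v = Re (herm u v)"
  by (simp add: herm_def inner_vec_def inner_complex_def)

lemma bounded_bilinear_herm: "bounded_bilinear (herm :: complex^'n \<Rightarrow> _)"
  unfolding bilinear_conv_bounded_bilinear [symmetric] bilinear_def
  by (auto intro!: linearI simp: herm_def algebra_simps sum.distrib scaleR_conv_of_real[where 'a=complex] sum_distrib_left)

lemma bounded_bilinear_smult:
  "bounded_bilinear ((*s) :: complex \<Rightarrow> complex^'n \<Rightarrow> complex^'n)"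
  unfolding bilinear_conv_bounded_bilinear [symmetric] bilinear_def
  by (auto intro!: linearI simp: vec_eq_iff algebra_simps scaleR_conv_of_real[where 'a=complex])

interpretation herm: bounded_bilinear herm
  by (rule bounded_bilinear_herm)

interpretation smult: bounded_bilinear "(*s) :: complex \<Rightarrow> complex^'n \<Rightarrow> complex^'n"
  by (rule bounded_bilinear_smult)

lemmas herm_simps = herm.add_left herm.add_right herm.diff_left herm.diff_right
  herm.minus_left herm.minus_right herm.zero_left herm.zero_right
  herm_smult_left herm_smult_right

lemma herm_self: "herm u u = of_real ((norm u)\<^sup>2)"
proof -
  have "Im (herm u u) = 0"
    using arg_cong [OF cnj_herm [of u u], of Im] by simp
  then show ?thesis
    by (simp add: complex_eq_iff power2_norm_eq_inner inner_eq_Re_herm)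
qed

lemma herm_self_eq_0_iff [simp]: "herm u u = 0 \<longleftrightarrow> u = 0"
  by (simp add: herm_self)

lemma Im_herm: "Im (herm u v) = u \<bullet> (\<i> *s v)"
  by (simp add: inner_eq_Re_herm herm_smult_right)

lemma scaleR_vec_eq_smult: "r *\<^sub>R (v :: complex^'n) = of_real r *s v"
  by (simp add: vec_eq_iff scaleR_conv_of_real[where 'a=complex])

section \<open>Smooth maps\<close>

lemma smooth_on_subset:
  assumes "smooth_on S f" "T \<subseteq> S"
  shows "smooth_on T f"
  using assms(1)
proof (coinduction arbitrary: f)
  case (smooth_on f)
  then obtain f' where "\<And>x. x \<in> S \<Longrightarrow> (f has_derivative f' x) (at x within S)"
    "\<And>v. smooth_on S (\<lambda>x. f' x v)"
    by cases (blast intro: that)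
  moreover have "(f has_derivative f' x) (at x within T)" if "x \<in> T" for x
    using calculation(1)[of x] that assms(2) by (meson has_derivative_subset subsetD)
  ultimately show ?case
    by blast
qed

lemma smooth_on_cong:
  assumes "smooth_on S f" "\<And>x. x \<in> S \<Longrightarrow> g x = f x"
  shows "smooth_on S g"
  using assms(1)
proof cases
  case (1 f')
  from 1(1) have "(g has_derivative f' x) (at x within S)" if "x \<in> S" for x
    using that assms(2) has_derivative_transform by metis
  then show ?thesis
    using 1(2) by (rule smooth_on.intros)
qed

lemma smooth_on_const: "smooth_on S (\<lambda>_. c)"
proof (coinduction arbitrary: c)
  case smooth_on
  show ?case
    by (intro exI[of _ "\<lambda>_. c"] exI[of _ "\<lambda>_ _. 0"] conjI refl allI impI disjI1 exI[of _ 0] has_derivative_const)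
qed

lemma smooth_on_imp_differentiable:
  assumes "smooth_on S f" "open S" "x \<in> S"
  shows "f differentiable (at x)"
  using assms(1) by cases (metis assms(2,3) at_within_open differentiable_def)

lemma smooth_on_imp_has_vector_derivative:
  assumes "smooth_on S f" "x \<in> S"
  shows "(f has_vector_derivative vector_derivative f (at x within S)) (at x within S)"
proof -
  have "f differentiable (at x within S)"
    using assms(1) by cases (use assms(2) in \<open>auto simp: differentiable_def\<close>)
  then show ?thesis
    by (simp add: vector_derivative_works)
qed

text \<open>Coinduction for \<open>smooth_on\<close> needs a class of maps that contains the
  Christoffel map for fixed vectors and is closed under directional derivatives away from 0. The
  generators are what the product and quotient rules produce: coordinates
  \<open>x \<bullet> a\<close> as factors and \<open>x \<bullet> x\<close> as denominator.\<close>

inductive rational_map :: "('a::euclidean_space \<Rightarrow> 'b::real_normed_vector) \<Rightarrow> bool" where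
  linear: "bounded_linear L \<Longrightarrow> rational_map L"
| const: "rational_map (\<lambda>_. c)"
| add: "rational_map f \<Longrightarrow> rational_map g \<Longrightarrow> rational_map (\<lambda>x. f x + g x)"
| scale: "rational_map f \<Longrightarrow> rational_map (\<lambda>x. r *\<^sub>R f x)"
| mult: "rational_map f \<Longrightarrow> rational_map (\<lambda>x. (x \<bullet> a) *\<^sub>R f x)"
| divide: "rational_map f \<Longrightarrow> rational_map (\<lambda>x. f x /\<^sub>R (x \<bullet> x))"

lemma rational_map_derivative:
  assumes "rational_map f"
  shows "\<exists>f'. (\<forall>x. x \<noteq> 0 \<longrightarrow> (f has_derivative f' x) (at x)) \<and> (\<forall>v. rational_map (\<lambda>x. f' x v))"
  using assms
proof induction
  case (linear L)
  then show ?case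
    by (intro exI[of _ "\<lambda>_. L"])
      (auto intro: rational_map.const bounded_linear_imp_has_derivative)
next
  case (const c)
  show ?case
    by (intro exI[of _ "\<lambda>_ _. 0"]) (auto intro: rational_map.const)
next
  case (add f g)
  then obtain f' g' where "\<forall>x. x \<noteq> 0 \<longrightarrow> (f has_derivative f' x) (at x)"
    "\<forall>v. rational_map (\<lambda>x. f' x v)" "\<forall>x. x \<noteq> 0 \<longrightarrow> (g has_derivative g' x) (at x)"
    "\<forall>v. rational_map (\<lambda>x. g' x v)" by blast
  then show ?case
    by (intro exI[of _ "\<lambda>x v. f' x v + g' x v"])
      (auto intro: rational_map.add has_derivative_add)
next
  case (scale f r)
  then obtain f' where "\<forall>x. x \<noteq> 0 \<longrightarrow> (f has_derivative f' x) (at x)"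
    "\<forall>v. rational_map (\<lambda>x. f' x v)" by blast
  then show ?case
    by (intro exI[of _ "\<lambda>x v. r *\<^sub>R f' x v"])
      (auto intro: rational_map.scale has_derivative_scaleR_right)
next
  case (mult f a)
  then obtain f' where f': "\<forall>x. x \<noteq> 0 \<longrightarrow> (f has_derivative f' x) (at x)"
    "\<forall>v. rational_map (\<lambda>x. f' x v)" by blast
  show ?case
  proof (intro exI[of _ "\<lambda>x v. (x \<bullet> a) *\<^sub>R f' x v + (v \<bullet> a) *\<^sub>R f x"] conjI allI impI)
    fix x :: 'a assume "x \<noteq> 0"
    then show "((\<lambda>x. (x \<bullet> a) *\<^sub>R f x) has_derivative
        (\<lambda>v. (x \<bullet> a) *\<^sub>R f' x v + (v \<bullet> a) *\<^sub>R f x)) (at x)"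
      using f'(1) by (auto intro!: derivative_eq_intros)
  next
    fix v
    show "rational_map (\<lambda>x. (x \<bullet> a) *\<^sub>R f' x v + (v \<bullet> a) *\<^sub>R f x)"
      using f'(2) mult.hyps by (intro rational_map.add rational_map.mult rational_map.scale) auto
  qed
next
  case (divide f)
  then obtain f' where f': "\<forall>x. x \<noteq> 0 \<longrightarrow> (f has_derivative f' x) (at x)"
    "\<forall>v. rational_map (\<lambda>x. f' x v)" by blast
  \<comment> \<open>The derivative of \<open>1 / (x \<bullet> x)\<close> is written as a coordinate
    factor \<open>x \<bullet> (- 2 *\<^sub>R v)\<close> followed by two divisions, so that it
    visibly stays in the class.\<close>
  show ?case
  proof (intro exI[of _ "\<lambda>x v. f' x v /\<^sub>R (x \<bullet> x)
        + (x \<bullet> (- 2 *\<^sub>R v)) *\<^sub>R (f x /\<^sub>R (x \<bullet> x)) /\<^sub>R (x \<bullet> x)"] conjI allI impI)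
    fix x :: 'a assume x: "x \<noteq> 0"
    have "((\<lambda>x. inverse (x \<bullet> x)) has_derivative
        (\<lambda>v. - (inverse (x \<bullet> x) * (2 * (x \<bullet> v)) * inverse (x \<bullet> x)))) (at x)"
      using x by (auto intro!: derivative_eq_intros simp: inner_commute)
    from has_derivative_scaleR[OF this f'(1)[rule_format, OF x]]
    show "((\<lambda>x. f x /\<^sub>R (x \<bullet> x)) has_derivative
        (\<lambda>v. f' x v /\<^sub>R (x \<bullet> x)
          + (x \<bullet> (- 2 *\<^sub>R v)) *\<^sub>R (f x /\<^sub>R (x \<bullet> x)) /\<^sub>R (x \<bullet> x))) (at x)"
      by (rule has_derivative_eq_rhs) (auto simp: fun_eq_iff mult_ac)
  next
    fix v
    show "rational_map (\<lambda>x. f' x v /\<^sub>R (x \<bullet> x)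
        + (x \<bullet> (- 2 *\<^sub>R v)) *\<^sub>R (f x /\<^sub>R (x \<bullet> x)) /\<^sub>R (x \<bullet> x))"
      using f'(2) divide.hyps
      by (intro rational_map.add rational_map.divide rational_map.mult) auto
  qed
qed

lemma smooth_on_rational_map:
  assumes "rational_map f"
  shows "smooth_on (- {0}) f"
  using assms
proof (coinduction arbitrary: f)
  case (smooth_on f)
  then obtain f' where "\<forall>x. x \<noteq> 0 \<longrightarrow> (f has_derivative f' x) (at x)"
    "\<forall>v. rational_map (\<lambda>x. f' x v)"
    using rational_map_derivative by blast
  moreover from this(1) have "(f has_derivative f' x) (at x within - {0})" if "x \<in> - {0}" for x
    using that by (auto intro: has_derivative_at_withinI)
  ultimately show ?case
    by blast
qed

text \<open>Differentiation in direction \<open>v\<close> turns the coefficients \<open>A\<close>,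
  \<open>B\<close>, \<open>C\<close> into \<open>0\<close>, \<open>v w C\<close>,
  \<open>- v w B\<close>. The family is closed under derivatives, and coinduction applies once the
  coefficients are generalised.\<close>

lemma smooth_on_trig:
  fixes A B C :: "'a::real_normed_vector"
  shows "smooth_on S (\<lambda>t. A + cos (w * (t - t0)) *\<^sub>R B + sin (w * (t - t0)) *\<^sub>R C)"
proof (coinduction arbitrary: A B C)
  case smooth_on
  let ?f' = "\<lambda>t v. 0 + cos (w * (t - t0)) *\<^sub>R ((v * w) *\<^sub>R C) + sin (w * (t - t0)) *\<^sub>R ((- (v * w)) *\<^sub>R B)"
  have "((\<lambda>t. A + cos (w * (t - t0)) *\<^sub>R B + sin (w * (t - t0)) *\<^sub>R C) has_derivative ?f' t) (at t within S)" for t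
    by (auto intro!: derivative_eq_intros simp: fun_eq_iff algebra_simps)
  moreover have "\<exists>A' B' C'. (\<lambda>t. ?f' t v) = (\<lambda>t. A' + cos (w * (t - t0)) *\<^sub>R B' + sin (w * (t - t0)) *\<^sub>R C')" for v
    by blast
  ultimately show ?case
    by (intro exI[of _ "\<lambda>t. A + cos (w * (t - t0)) *\<^sub>R B + sin (w * (t - t0)) *\<^sub>R C"]
      exI[of _ ?f'] conjI allI impI disjI1 refl)
qed

section \<open>The Bismut connection\<close>

text \<open>Keeping only the real parts of the three Hermitian products gives the Levi-Civita
  connection of the conformally flat metric \<open>u \<bullet> v / |x|^2\<close>. The imaginary
  parts add a 3-form, namely half of the torsion.\<close>

definition hopf_christoffel :: "complex^'n \<Rightarrow> complex^'n \<Rightarrow> complex^'n \<Rightarrow> complex^'n" where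
  "hopf_christoffel x u v =
     (herm v u *s x - herm x u *s v - herm v x *s u) /\<^sub>R (x \<bullet> x)"

lemma hopf_christoffel_smult_right:
  "hopf_christoffel x u (c *s v) = c *s hopf_christoffel x u v"
  by (simp add: hopf_christoffel_def vec_eq_iff herm_simps algebra_simps)

text \<open>The terms along \<open>x\<close> and along \<open>u\<close> cancel in pairs between the
  two summands. Divided by \<open>x \<bullet> x\<close>, the right-hand side is the derivative of
  \<open>herm v w / (x \<bullet> x)\<close> in direction \<open>u\<close>, so the real part is
  metric compatibility; the full complex identity later makes the pairing of parallel fields
  constant.\<close>

lemma herm_hopf_christoffel:
  assumes "x \<noteq> 0"
  shows "herm (hopf_christoffel x u v) w + herm v (hopf_christoffel x u w)
       = - (2 * (x \<bullet> u) / (x \<bullet> x)) *\<^sub>R herm v w"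
proof -
  have "herm ((x \<bullet> x) *\<^sub>R hopf_christoffel x u v) w + herm v ((x \<bullet> x) *\<^sub>R hopf_christoffel x u w)
      = - (herm x u + cnj (herm x u)) * herm v w"
    using assms by (simp add: hopf_christoffel_def herm_simps cnj_herm algebra_simps)
  also have "\<dots> = - (2 * (x \<bullet> u)) *\<^sub>R herm v w"
    by (simp add: inner_eq_Re_herm complex_add_cnj scaleR_conv_of_real)
  finally have "(x \<bullet> x) *\<^sub>R (herm (hopf_christoffel x u v) w + herm v (hopf_christoffel x u w))
      = - (2 * (x \<bullet> u)) *\<^sub>R herm v w"
    by (simp add: herm.scaleR_left herm.scaleR_right scaleR_add_right)
  then have "(x \<bullet> x) *\<^sub>R (herm (hopf_christoffel x u v) w + herm v (hopf_christoffel x u w))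
      = (x \<bullet> x) *\<^sub>R (- (2 * (x \<bullet> u) / (x \<bullet> x)) *\<^sub>R herm v w)"
    using assms by simp
  then show ?thesis
    using assms by (simp only: real_vector.scale_cancel_left) simp
qed

text \<open>The real parts are symmetric in \<open>u\<close> and \<open>v\<close> and drop out; the
  imaginary parts are counted twice. The result is a cyclic sum of products of values of the skew
  form \<open>a \<bullet> (\<i> *s b)\<close>, from which total skewness can be read off.\<close>

lemma hopf_christoffel_torsion:
  "(hopf_christoffel x u v - hopf_christoffel x v u) \<bullet> w
     = 2 * ((x \<bullet> (\<i> *s u)) * (v \<bullet> (\<i> *s w)) + (x \<bullet> (\<i> *s v)) * (w \<bullet> (\<i> *s u))
          + (x \<bullet> (\<i> *s w)) * (u \<bullet> (\<i> *s v))) / (x \<bullet> x)"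
proof -
  have re: "Re (herm b a) = Re (herm a b)" and im: "Im (herm b a) = - Im (herm a b)" for a b :: "complex^'n"
    using cnj_herm[of a b] by (auto simp: complex_eq_iff)
  have "hopf_christoffel x u v - hopf_christoffel x v u =
      ((herm v u - herm u v) *s x + (herm u x - herm x u) *s v + (herm x v - herm v x) *s u) /\<^sub>R (x \<bullet> x)"
    by (simp add: hopf_christoffel_def vec_eq_iff algebra_simps)
  moreover have "((herm v u - herm u v) *s x + (herm u x - herm x u) *s v + (herm x v - herm v x) *s u) \<bullet> w
      = 2 * ((x \<bullet> (\<i> *s u)) * (v \<bullet> (\<i> *s w)) + (x \<bullet> (\<i> *s v)) * (w \<bullet> (\<i> *s u))
          + (x \<bullet> (\<i> *s w)) * (u \<bullet> (\<i> *s v)))"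
    unfolding inner_eq_Re_herm[of _ w] Im_herm[symmetric]
    by (simp add: herm_simps re[of x] re[of u v] im[of x] im[of u v] im[of w u] algebra_simps)
  ultimately show ?thesis
    by (simp add: divide_inverse)
qed

lemma bilinear_hopf_christoffel: "bilinear (hopf_christoffel x)"
  unfolding bilinear_def hopf_christoffel_def
  by (auto intro!: linearI simp: herm_simps herm.scaleR_left herm.scaleR_right vec_eq_iff
      algebra_simps)

lemma smooth_on_hopf_christoffel:
  "smooth_on (- {0}) (\<lambda>x :: complex^'n. hopf_christoffel x u v)"
proof -
  have "bounded_linear (\<lambda>x :: complex^'n. herm v u *s x - herm x u *s v - herm v x *s u)"
    by (intro bounded_linear_sub smult.bounded_linear_right
        bounded_linear_compose[OF smult.bounded_linear_left] herm.bounded_linear_left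
        herm.bounded_linear_right)
  then show ?thesis
    unfolding hopf_christoffel_def
    by (intro smooth_on_rational_map rational_map.divide rational_map.linear)
qed

lemma cov_deriv_const: "cov_deriv C (\<lambda>_. u) (\<lambda>_. v) x = C x u v"
  by (simp add: cov_deriv_def)

lemma conn_torsion_eq: "conn_torsion C X Y x = C x (X x) (Y x) - C x (Y x) (X x)"
  by (simp add: conn_torsion_def cov_deriv_def lie_bracket_def)

lemma is_bismut_connection_hopf_christoffel:
  "is_bismut_connection (- {0}) hopf_metric hopf_J hopf_christoffel"
  unfolding is_bismut_connection_def
proof (intro conjI)
  show "is_connection (- {0}) (hopf_christoffel :: complex^'n \<Rightarrow> _)"
    by (simp add: is_connection_def bilinear_hopf_christoffel smooth_on_hopf_christoffel)
      (simp add: hopf_christoffel_def)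
  show "metric_compatible (- {0}) hopf_metric (hopf_christoffel :: complex^'n \<Rightarrow> _)"
    unfolding metric_compatible_def
  proof (intro allI impI ballI)
    fix X Y Z :: "complex^'n \<Rightarrow> complex^'n" and x :: "complex^'n"
    assume sm: "smooth_on (- {0}) Y" "smooth_on (- {0}) Z" and x: "x \<in> - {0}"
    define Y' Z' where "Y' = frechet_derivative Y (at x)" and "Z' = frechet_derivative Z (at x)"
    have der: "(Y has_derivative Y') (at x)" "(Z has_derivative Z') (at x)"
      using smooth_on_imp_differentiable[OF _ _ x] sm
      unfolding Y'_def Z'_def by (auto simp: frechet_derivative_works[symmetric])
    have "((\<lambda>y. (Y y \<bullet> Z y) / (y \<bullet> y)) has_derivative
        (\<lambda>u. (Y' u \<bullet> Z x + Y x \<bullet> Z' u - 2 * (x \<bullet> u) / (x \<bullet> x) * (Y x \<bullet> Z x)) / (x \<bullet> x))) (at x)"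
      using x by (auto intro!: derivative_eq_intros der simp: inner_commute field_simps power2_eq_square)
    then have "frechet_derivative (\<lambda>y. hopf_metric y (Y y) (Z y)) (at x) (X x) =
        (Y' (X x) \<bullet> Z x + Y x \<bullet> Z' (X x) - 2 * (x \<bullet> X x) / (x \<bullet> x) * (Y x \<bullet> Z x)) / (x \<bullet> x)"
      by (simp add: hopf_metric_def power2_norm_eq_inner frechet_derivative_at[symmetric])
    moreover have "hopf_christoffel x (X x) (Y x) \<bullet> Z x + Y x \<bullet> hopf_christoffel x (X x) (Z x) =
        - (2 * (x \<bullet> X x) / (x \<bullet> x) * (Y x \<bullet> Z x))"
      using arg_cong[OF herm_hopf_christoffel[of x "X x" "Y x" "Z x"], of Re] x
      by (simp add: inner_eq_Re_herm)
    ultimately show "frechet_derivative (\<lambda>y. hopf_metric y (Y y) (Z y)) (at x) (X x) =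
        hopf_metric x (cov_deriv hopf_christoffel X Y x) (Z x) +
        hopf_metric x (Y x) (cov_deriv hopf_christoffel X Z x)"
      by (simp add: hopf_metric_def cov_deriv_def power2_norm_eq_inner inner_add_left inner_add_right
          flip: add_divide_distrib Y'_def Z'_def)
  qed
  show "complex_compatible (- {0}) hopf_J (hopf_christoffel :: complex^'n \<Rightarrow> _)"
    unfolding complex_compatible_def
  proof (intro allI impI ballI)
    fix X Y :: "complex^'n \<Rightarrow> complex^'n" and x :: "complex^'n"
    assume sm: "smooth_on (- {0}) Y" and x: "x \<in> - {0}"
    have "(Y has_derivative frechet_derivative Y (at x)) (at x)"
      using smooth_on_imp_differentiable[OF sm _ x] by (auto simp: frechet_derivative_works[symmetric])
    from bounded_linear.has_derivative[OF smult.bounded_linear_right this]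
    have "frechet_derivative (\<lambda>y. \<i> *s Y y) (at x) = (\<lambda>u. \<i> *s frechet_derivative Y (at x) u)"
      by (metis frechet_derivative_at)
    then show "cov_deriv hopf_christoffel X (\<lambda>y. hopf_J y (Y y)) x
        = hopf_J x (cov_deriv hopf_christoffel X Y x)"
      by (simp add: cov_deriv_def hopf_J_def hopf_christoffel_smult_right smult.add_right)
  qed
  show "skew_torsion (- {0}) hopf_metric (hopf_christoffel :: complex^'n \<Rightarrow> _)"
  proof -
    have skew: "a \<bullet> (\<i> *s b) = - (b \<bullet> (\<i> *s a))" for a b :: "complex^'n"
      using cnj_herm[of b a] by (auto simp: complex_eq_iff Im_herm)
    show ?thesis
      unfolding skew_torsion_def conn_torsion_eq hopf_metric_def hopf_christoffel_torsion
    proof (intro allI impI ballI)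
      fix X Y Z :: "complex^'n \<Rightarrow> complex^'n" and x :: "complex^'n"
      note [simp] = skew[of "X x" "Y x"] skew[of "X x" "Z x"] skew[of "Y x" "Z x"]
      show "2 * (x \<bullet> (\<i> *s X x) * (Y x \<bullet> (\<i> *s Z x)) + x \<bullet> (\<i> *s Y x) * (Z x \<bullet> (\<i> *s X x)) + x \<bullet> (\<i> *s Z x) * (X x \<bullet> (\<i> *s Y x))) / (x \<bullet> x) / (norm x)\<^sup>2 =
       - (2 * (x \<bullet> (\<i> *s Y x) * (X x \<bullet> (\<i> *s Z x)) + x \<bullet> (\<i> *s X x) * (Z x \<bullet> (\<i> *s Y x)) + x \<bullet> (\<i> *s Z x) * (Y x \<bullet> (\<i> *s X x))) / (x \<bullet> x) / (norm x)\<^sup>2) \<and>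
       2 * (x \<bullet> (\<i> *s X x) * (Y x \<bullet> (\<i> *s Z x)) + x \<bullet> (\<i> *s Y x) * (Z x \<bullet> (\<i> *s X x)) + x \<bullet> (\<i> *s Z x) * (X x \<bullet> (\<i> *s Y x))) / (x \<bullet> x) / (norm x)\<^sup>2 =
       - (2 * (x \<bullet> (\<i> *s X x) * (Z x \<bullet> (\<i> *s Y x)) + x \<bullet> (\<i> *s Z x) * (Y x \<bullet> (\<i> *s X x)) + x \<bullet> (\<i> *s Y x) * (X x \<bullet> (\<i> *s Z x))) / (x \<bullet> x) / (norm x)\<^sup>2)"
        by (auto simp: algebra_simps add_divide_distrib diff_divide_distrib)
    qed
  qed
qed

text \<open>
  The difference of two Bismut connections is, after lowering an index, a 3-form \<open>a\<close> in which
  moving \<open>J\<close> from one slot to another changes the sign. Moving it around the three slots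
  gives \<open>a u v (J w) = - a u v (J w)\<close>.
\<close>

lemma bismut_connection_unique:
  fixes C C' :: "complex^'n \<Rightarrow> complex^'n \<Rightarrow> complex^'n \<Rightarrow> complex^'n"
  assumes C: "is_bismut_connection (- {0}) hopf_metric hopf_J C"
    and C': "is_bismut_connection (- {0}) hopf_metric hopf_J C'"
  shows "C = C'"
proof (intro ext)
  fix x u v :: "complex^'n"
  show "C x u v = C' x u v"
  proof (cases "x = 0")
    case True
    with C C' show ?thesis
      by (simp add: is_bismut_connection_def is_connection_def)
  next
    case False
    define a where "a u v w = (C x u v - C' x u v) \<bullet> w" for u v w
    have ne: "x \<in> - {0}" "(norm x)\<^sup>2 \<noteq> 0"
      using False by auto
    \<comment> \<open>Constant fields suffice, since on them \<open>cov_deriv\<close> is the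
      Christoffel map itself. The left-hand side does not mention \<open>D\<close>, so it disappears
      when the identities for \<open>C\<close> and \<open>C'\<close> are subtracted.\<close>
    have metric: "frechet_derivative (\<lambda>y. hopf_metric y v w) (at x) u
        = hopf_metric x (D x u v) w + hopf_metric x v (D x u w)"
      if "is_bismut_connection (- {0}) hopf_metric hopf_J D" for D u v w
    proof -
      have "metric_compatible (- {0}) hopf_metric D"
        using that by (simp add: is_bismut_connection_def)
      from this[unfolded metric_compatible_def, rule_format,
          of "\<lambda>_. u" "\<lambda>_. v" "\<lambda>_. w" x] show ?thesis
        using ne by (simp add: smooth_on_const cov_deriv_const)
    qed
    have J: "D x u (\<i> *s v) = \<i> *s D x u v"
      if "is_bismut_connection (- {0}) hopf_metric hopf_J D" for D u v
    proof -
      have "complex_compatible (- {0}) hopf_J D"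
        using that by (simp add: is_bismut_connection_def)
      from this[unfolded complex_compatible_def hopf_J_def, rule_format,
          of "\<lambda>_. u" "\<lambda>_. v" x] show ?thesis
        using ne by (simp add: smooth_on_const cov_deriv_const)
    qed
    have torsion: "(D x u v - D x v u) \<bullet> w = - ((D x u w - D x w u) \<bullet> v)"
      if "is_bismut_connection (- {0}) hopf_metric hopf_J D" for D u v w
    proof -
      have "skew_torsion (- {0}) hopf_metric D"
        using that by (simp add: is_bismut_connection_def)
      from this[unfolded skew_torsion_def, rule_format,
          of "\<lambda>_. u" "\<lambda>_. v" "\<lambda>_. w" x] show ?thesis
        using ne by (simp add: smooth_on_const conn_torsion_eq hopf_metric_def field_simps)
    qed
    have a23: "a u v w = - a u w v" for u v w
      using metric[OF C, of v w u] metric[OF C', of v w u] ne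
      by (simp add: a_def hopf_metric_def field_simps inner_diff_left inner_diff_right inner_commute)
    have "a u v w - a v u w = - (a u w v - a w u v)" for u v w
      using torsion[OF C, of u v w] torsion[OF C', of u v w]
      by (simp add: a_def inner_diff_left)
    \<comment> \<open>By \<open>a23\<close> the two terms with first slot \<open>u\<close> and
      arguments \<open>v\<close>, \<open>w\<close> cancel; what remains is skewness in the outer
      slots.\<close>
    then have a13: "a v u w = - a w u v" for u v w
      using a23[of u v w] by (smt (verit))
    have aJ: "a u (\<i> *s v) w = - a u v (\<i> *s w)" for u v w
    proof -
      have "(\<i> *s p) \<bullet> w = - (p \<bullet> (\<i> *s w))" for p :: "complex^'n"
        by (simp add: inner_eq_Re_herm herm_smult_left herm_smult_right)
      moreover have "C x u (\<i> *s v) - C' x u (\<i> *s v) = \<i> *s (C x u v - C' x u v)"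
        by (simp add: J[OF C] J[OF C'] smult.diff_right)
      ultimately show ?thesis
        by (simp only: a_def)
    qed
    have "a u v (\<i> *s w) = 0" for u v w
    proof -
      have "a u v (\<i> *s w) = - a (\<i> *s w) v u"
        by (rule a13)
      also have "\<dots> = a v (\<i> *s w) u"
        using a23[of "\<i> *s w" v u] a13[of "\<i> *s w" u v] a23[of v u "\<i> *s w"] by simp
      also have "\<dots> = - a v w (\<i> *s u)"
        by (rule aJ)
      also have "\<dots> = a w v (\<i> *s u)"
        using a23[of v w "\<i> *s u"] a13[of v "\<i> *s u" w] a23[of w "\<i> *s u" v] by simp
      also have "\<dots> = - a w (\<i> *s v) u"
        by (simp add: aJ)
      also have "\<dots> = a u (\<i> *s v) w"
        using a13[of w "\<i> *s v" u] by simp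
      also have "\<dots> = - a u v (\<i> *s w)"
        by (rule aJ)
      finally show ?thesis
        by simp
    qed
    \<comment> \<open>For this choice of \<open>w\<close> the vector \<open>\<i> *s w\<close> is the
      difference of the two connections, and \<open>a\<close> becomes its squared length.\<close>
    from this[of u v "(- \<i>) *s (C x u v - C' x u v)"] show ?thesis
      by (simp add: a_def vector_smult_assoc)
  qed
qed

lemma hopf_bismut_eq: "hopf_bismut = hopf_christoffel"
  unfolding hopf_bismut_def bismut_connection_def
  using is_bismut_connection_hopf_christoffel bismut_connection_unique
  by (metis (mono_tags) the_equality)

section \<open>Parallel fields on the Hopf manifold\<close>

lemma hopf_tproj_eq_iff:
  assumes "lam > 1"
  shows "hopf_tproj lam x v = hopf_tproj lam y w \<longleftrightarrow>
    (\<exists>k. y = (lam powi k) *\<^sub>R x \<and> w = (lam powi k) *\<^sub>R v)"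
proof
  assume "hopf_tproj lam x v = hopf_tproj lam y w"
  moreover have "(y, w) \<in> hopf_tproj lam y w"
    by (auto simp: hopf_tproj_def intro!: exI[of _ 0])
  ultimately have "(y, w) \<in> hopf_tproj lam x v"
    by simp
  then show "\<exists>k. y = (lam powi k) *\<^sub>R x \<and> w = (lam powi k) *\<^sub>R v"
    by (auto simp: hopf_tproj_def)
next
  assume "\<exists>k. y = (lam powi k) *\<^sub>R x \<and> w = (lam powi k) *\<^sub>R v"
  then obtain k where k: "y = (lam powi k) *\<^sub>R x" "w = (lam powi k) *\<^sub>R v"
    by blast
  have "\<exists>i. j = i + k" for j
    by (rule exI[of _ "j - k"]) simp
  moreover have "(lam powi j) * (lam powi k) = lam powi (j + k)" for j
    using assms by (simp add: power_int_add)
  ultimately show "hopf_tproj lam x v = hopf_tproj lam y w"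
    unfolding hopf_tproj_def k by (auto simp: set_eq_iff) metis+
qed

lemma hopf_proj_eq_iff:
  assumes "lam > 1"
  shows "hopf_proj lam x = hopf_proj lam y \<longleftrightarrow> (\<exists>k. y = (lam powi k) *\<^sub>R x)"
proof
  assume "hopf_proj lam x = hopf_proj lam y"
  moreover have "y \<in> hopf_proj lam y"
    by (auto simp: hopf_proj_def intro!: exI[of _ 0])
  ultimately have "y \<in> hopf_proj lam x"
    by simp
  then show "\<exists>k. y = (lam powi k) *\<^sub>R x"
    by (auto simp: hopf_proj_def)
next
  assume "\<exists>k. y = (lam powi k) *\<^sub>R x"
  then have "hopf_tproj lam x x = hopf_tproj lam y y"
    using assms by (auto simp: hopf_tproj_eq_iff)
  moreover have "hopf_proj lam z = fst ` hopf_tproj lam z z" for z :: "complex^'a"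
    by (auto simp: hopf_proj_def hopf_tproj_def image_iff)
  ultimately show "hopf_proj lam x = hopf_proj lam y"
    by simp
qed

lemma hopf_tangent_hopf_proj:
  assumes "lam > 1"
  shows "hopf_tangent lam (hopf_proj lam x) = range (hopf_tproj lam x)"
proof (intro equalityI subsetI)
  fix \<xi> assume "\<xi> \<in> hopf_tangent lam (hopf_proj lam x)"
  then obtain k v where \<xi>: "\<xi> = hopf_tproj lam ((lam powi k) *\<^sub>R x) v"
    by (auto simp: hopf_tangent_def hopf_proj_def)
  have "hopf_tproj lam x (v /\<^sub>R (lam powi k)) = \<xi>"
    unfolding \<xi> hopf_tproj_eq_iff[OF assms] using assms by (intro exI[of _ k]) simp
  then show "\<xi> \<in> range (hopf_tproj lam x)"
    by blast
next
  fix \<xi> assume "\<xi> \<in> range (hopf_tproj lam x)"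
  moreover have "x \<in> hopf_proj lam x"
    by (auto simp: hopf_proj_def intro!: exI[of _ 0])
  ultimately show "\<xi> \<in> hopf_tangent lam (hopf_proj lam x)"
    by (auto simp: hopf_tangent_def)
qed

text \<open>The Hermitian form of the Hopf manifold, read off from orbits. Both vectors are
  represented at a common foot \<open>x\<close>, and division by \<open>x \<bullet> x\<close>
  compensates the factor that a change of foot puts on \<open>herm\<close>. A nonzero foot
  determines the exponent of \<open>lam\<close>, which makes the value unique.\<close>

definition hopf_pairing ::
  "((complex^'n) \<times> (complex^'n)) set \<Rightarrow> ((complex^'n) \<times> (complex^'n)) set \<Rightarrow> complex" where
  "hopf_pairing \<xi> \<eta> = (THE z. \<exists>x v w. (x, v) \<in> \<xi> \<and> (x, w) \<in> \<eta> \<and> z = herm v w /\<^sub>R (x \<bullet> x))"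

lemma hopf_pairing_hopf_tproj:
  assumes "lam > 1" "x \<noteq> 0"
  shows "hopf_pairing (hopf_tproj lam x v) (hopf_tproj lam x w) = herm v w /\<^sub>R (x \<bullet> x)"
  unfolding hopf_pairing_def
proof (rule the_equality)
  show "\<exists>y v' w'. (y, v') \<in> hopf_tproj lam x v \<and> (y, w') \<in> hopf_tproj lam x w \<and>
      herm v w /\<^sub>R (x \<bullet> x) = herm v' w' /\<^sub>R (y \<bullet> y)"
    by (intro exI[of _ x] exI[of _ v] exI[of _ w]) (auto simp: hopf_tproj_def intro!: exI[of _ 0])
next
  fix z
  assume "\<exists>y v' w'. (y, v') \<in> hopf_tproj lam x v \<and> (y, w') \<in> hopf_tproj lam x w \<and>
      z = herm v' w' /\<^sub>R (y \<bullet> y)"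
  then obtain j k where jk: "(lam powi j) *\<^sub>R x = (lam powi k) *\<^sub>R x"
    and z: "z = herm ((lam powi j) *\<^sub>R v) ((lam powi k) *\<^sub>R w) /\<^sub>R
      (((lam powi j) *\<^sub>R x) \<bullet> ((lam powi j) *\<^sub>R x))"
    unfolding hopf_tproj_def by blast
  from jk assms(2) have "lam powi k = lam powi j"
    by simp
  moreover have "inverse (lam powi j) * (inverse (lam powi j) * (lam powi j * lam powi j)) = 1"
    using assms(1) by (simp add: field_simps)
  ultimately show "z = herm v w /\<^sub>R (x \<bullet> x)"
    by (simp add: z herm.scaleR_left herm.scaleR_right mult_ac)
qed

section \<open>Local lifts of curves and of parallel fields\<close>

lemma at_within_Int_ball:
  fixes t :: "'a::metric_space"
  assumes "s \<in> ball t \<epsilon>"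
  shows "at s within (S \<inter> ball t \<epsilon>) = at s within S"
  by (rule at_within_nhd[of _ "ball t \<epsilon>"]) (use assms in auto)

text \<open>A working form of the definition. Derivatives are taken within the whole interval, so
  they survive passage to smaller balls, and the velocity is any \<open>\<gamma>'\<close> given by a
  derivative statement. The assumption \<open>a < b\<close> makes derivatives within the interval
  unique, which identifies \<open>\<gamma>'\<close> with \<open>vector_derivative\<close>.\<close>

lemma hopf_parallel_on_iff:
  assumes "a < b"
  shows "hopf_parallel_on lam a b c V \<longleftrightarrow>
    (\<forall>t\<in>{a..b}. \<exists>\<epsilon>>0. \<exists>\<gamma> \<gamma>' v. smooth_on ({a..b} \<inter> ball t \<epsilon>) \<gamma> \<and>
       (\<forall>s\<in>{a..b} \<inter> ball t \<epsilon>.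
          \<gamma> s \<noteq> 0 \<and> c s = hopf_proj lam (\<gamma> s) \<and> V s = hopf_tproj lam (\<gamma> s) (v s) \<and>
          (\<gamma> has_vector_derivative \<gamma>' s) (at s within {a..b}) \<and>
          (v has_vector_derivative - hopf_christoffel (\<gamma> s) (\<gamma>' s) (v s)) (at s within {a..b})))"
  (is "?L \<longleftrightarrow> (\<forall>t\<in>_. ?R t)")
proof
  assume L: ?L
  show "\<forall>t\<in>{a..b}. ?R t"
  proof
    fix t assume "t \<in> {a..b}"
    from bspec[OF L[unfolded hopf_parallel_on_def hopf_bismut_eq] this] obtain \<epsilon> \<gamma> v where
      "\<epsilon> > 0" and sm: "smooth_on ({a..b} \<inter> ball t \<epsilon>) \<gamma>" and
      \<gamma>: "\<And>s. s \<in> {a..b} \<inter> ball t \<epsilon> \<Longrightarrow>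
           \<gamma> s \<noteq> 0 \<and> c s = hopf_proj lam (\<gamma> s) \<and> V s = hopf_tproj lam (\<gamma> s) (v s) \<and>
           (v has_vector_derivative
              - hopf_christoffel (\<gamma> s) (vector_derivative \<gamma> (at s within {a..b} \<inter> ball t \<epsilon>)) (v s))
             (at s within {a..b} \<inter> ball t \<epsilon>)"
      by blast
    show "?R t"
    proof (rule exI[of _ \<epsilon>], rule conjI, rule \<open>\<epsilon> > 0\<close>, rule exI[of _ \<gamma>],
        rule exI[of _ "\<lambda>s. vector_derivative \<gamma> (at s within {a..b} \<inter> ball t \<epsilon>)"],
        rule exI[of _ v], intro conjI ballI)
      fix s assume s: "s \<in> {a..b} \<inter> ball t \<epsilon>"
      note eq = at_within_Int_ball[of s t \<epsilon> "{a..b}"]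
      show "(\<gamma> has_vector_derivative vector_derivative \<gamma> (at s within {a..b} \<inter> ball t \<epsilon>))
          (at s within {a..b})"
        using smooth_on_imp_has_vector_derivative[OF sm s] s eq by simp
      show "(v has_vector_derivative
          - hopf_christoffel (\<gamma> s) (vector_derivative \<gamma> (at s within {a..b} \<inter> ball t \<epsilon>)) (v s))
          (at s within {a..b})"
        using \<gamma>[OF s] s eq by simp
    qed (use sm \<gamma> in auto)
  qed
next
  assume R: "\<forall>t\<in>{a..b}. ?R t"
  show ?L
    unfolding hopf_parallel_on_def hopf_bismut_eq
  proof
    fix t assume "t \<in> {a..b}"
    from bspec[OF R this] obtain \<epsilon> \<gamma> \<gamma>' v where
      "\<epsilon> > 0" and sm: "smooth_on ({a..b} \<inter> ball t \<epsilon>) \<gamma>" and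
      \<gamma>: "\<And>s. s \<in> {a..b} \<inter> ball t \<epsilon> \<Longrightarrow>
          \<gamma> s \<noteq> 0 \<and> c s = hopf_proj lam (\<gamma> s) \<and> V s = hopf_tproj lam (\<gamma> s) (v s) \<and>
          (\<gamma> has_vector_derivative \<gamma>' s) (at s within {a..b}) \<and>
          (v has_vector_derivative - hopf_christoffel (\<gamma> s) (\<gamma>' s) (v s)) (at s within {a..b})"
      by blast
    show "\<exists>\<epsilon>>0. \<exists>\<gamma> v. smooth_on ({a..b} \<inter> ball t \<epsilon>) \<gamma> \<and>
        (\<forall>s\<in>{a..b} \<inter> ball t \<epsilon>.
           \<gamma> s \<noteq> 0 \<and> c s = hopf_proj lam (\<gamma> s) \<and> V s = hopf_tproj lam (\<gamma> s) (v s) \<and>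
           (v has_vector_derivative
              - hopf_christoffel (\<gamma> s) (vector_derivative \<gamma> (at s within {a..b} \<inter> ball t \<epsilon>)) (v s))
             (at s within {a..b} \<inter> ball t \<epsilon>))"
    proof (rule exI[of _ \<epsilon>], rule conjI, rule \<open>\<epsilon> > 0\<close>, rule exI[of _ \<gamma>],
        rule exI[of _ v], intro conjI ballI)
      fix s assume s: "s \<in> {a..b} \<inter> ball t \<epsilon>"
      note eq = at_within_Int_ball[of s t \<epsilon> "{a..b}"]
      have "vector_derivative \<gamma> (at s within {a..b}) = \<gamma>' s"
        using vector_derivative_within_cbox[of a b s \<gamma> "\<gamma>' s"] assms \<gamma>[OF s] s by simp
      then show "(v has_vector_derivative
              - hopf_christoffel (\<gamma> s) (vector_derivative \<gamma> (at s within {a..b} \<inter> ball t \<epsilon>)) (v s))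
             (at s within {a..b} \<inter> ball t \<epsilon>)"
        using \<gamma>[OF s] s eq by simp
    qed (use sm \<gamma> in auto)
  qed
qed

text \<open>Two parallel fields along one curve may come with different subdivisions; they become
  comparable after restriction to the overlap of two pieces.\<close>

lemma hopf_parallel_on_subinterval:
  assumes "hopf_parallel_on lam a b c V" "a \<le> a'" "a' < b'" "b' \<le> b"
  shows "hopf_parallel_on lam a' b' c V"
proof -
  have "a < b"
    using assms(2-4) by simp
  show ?thesis
    unfolding hopf_parallel_on_iff[OF assms(3)]
  proof
    fix t assume t: "t \<in> {a'..b'}"
    then have "t \<in> {a..b}"
      using assms by auto
    from bspec[OF assms(1)[unfolded hopf_parallel_on_iff[OF \<open>a < b\<close>]] this] obtain \<epsilon> \<gamma> \<gamma>' v where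
      \<gamma>: "\<epsilon> > 0" "smooth_on ({a..b} \<inter> ball t \<epsilon>) \<gamma>"
      "\<And>s. s \<in> {a..b} \<inter> ball t \<epsilon> \<Longrightarrow>
          \<gamma> s \<noteq> 0 \<and> c s = hopf_proj lam (\<gamma> s) \<and> V s = hopf_tproj lam (\<gamma> s) (v s) \<and>
          (\<gamma> has_vector_derivative \<gamma>' s) (at s within {a..b}) \<and>
          (v has_vector_derivative - hopf_christoffel (\<gamma> s) (\<gamma>' s) (v s)) (at s within {a..b})"
      by blast
    have sub: "{a'..b'} \<subseteq> {a..b}"
      using assms by auto
    show "\<exists>\<epsilon>>0. \<exists>\<gamma> \<gamma>' v. smooth_on ({a'..b'} \<inter> ball t \<epsilon>) \<gamma> \<and>
       (\<forall>s\<in>{a'..b'} \<inter> ball t \<epsilon>.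
          \<gamma> s \<noteq> 0 \<and> c s = hopf_proj lam (\<gamma> s) \<and> V s = hopf_tproj lam (\<gamma> s) (v s) \<and>
          (\<gamma> has_vector_derivative \<gamma>' s) (at s within {a'..b'}) \<and>
          (v has_vector_derivative - hopf_christoffel (\<gamma> s) (\<gamma>' s) (v s)) (at s within {a'..b'}))"
    proof (rule exI[of _ \<epsilon>], rule conjI, rule \<gamma>(1), rule exI[of _ \<gamma>], rule exI[of _ \<gamma>'],
        rule exI[of _ v], intro conjI ballI)
      show "smooth_on ({a'..b'} \<inter> ball t \<epsilon>) \<gamma>"
        using smooth_on_subset[OF \<gamma>(2)] sub by blast
      fix s assume "s \<in> {a'..b'} \<inter> ball t \<epsilon>"
      then have s: "s \<in> {a..b} \<inter> ball t \<epsilon>"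
        using sub by blast
      note * = has_vector_derivative_within_subset[OF _ sub]
      show "\<gamma> s \<noteq> 0" "c s = hopf_proj lam (\<gamma> s)" "V s = hopf_tproj lam (\<gamma> s) (v s)"
        "(\<gamma> has_vector_derivative \<gamma>' s) (at s within {a'..b'})"
        "(v has_vector_derivative - hopf_christoffel (\<gamma> s) (\<gamma>' s) (v s)) (at s within {a'..b'})"
        using \<gamma>(3)[OF s] * by blast+
    qed
  qed
qed

text \<open>The derivative of \<open>1 / (x s \<bullet> x s)\<close> cancels the factor supplied by
  \<open>herm_hopf_christoffel\<close>.\<close>

lemma parallel_herm_derivative:
  assumes x: "(x has_vector_derivative x') (at s within S)" "x s \<noteq> 0"
    and v: "(v has_vector_derivative - hopf_christoffel (x s) x' (v s)) (at s within S)"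
    and w: "(w has_vector_derivative - hopf_christoffel (x s) x' (w s)) (at s within S)"
  shows "((\<lambda>s. herm (v s) (w s) /\<^sub>R (x s \<bullet> x s)) has_vector_derivative 0) (at s within S)"
proof -
  have "((\<lambda>s. x s \<bullet> x s) has_real_derivative 2 * (x s \<bullet> x')) (at s within S)"
    using bounded_bilinear.has_vector_derivative[OF bounded_bilinear_inner x(1) x(1)]
    by (simp add: has_real_derivative_iff_has_vector_derivative inner_commute)
  from DERIV_inverse'[OF this] x(2)
  have "((\<lambda>s. inverse (x s \<bullet> x s)) has_real_derivative
      - (2 * (x s \<bullet> x') * inverse (x s \<bullet> x s) * inverse (x s \<bullet> x s))) (at s within S)"
    by (simp add: mult_ac)
  from has_vector_derivative_scaleR[OF this herm.has_vector_derivative[OF v w]]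
  have "((\<lambda>s. herm (v s) (w s) /\<^sub>R (x s \<bullet> x s)) has_vector_derivative
      inverse (x s \<bullet> x s) *\<^sub>R (herm (v s) (- hopf_christoffel (x s) x' (w s)) +
        herm (- hopf_christoffel (x s) x' (v s)) (w s)) +
      - (2 * (x s \<bullet> x') * inverse (x s \<bullet> x s) * inverse (x s \<bullet> x s)) *\<^sub>R herm (v s) (w s)) (at s within S)" .
  moreover have "herm (v s) (- hopf_christoffel (x s) x' (w s)) +
        herm (- hopf_christoffel (x s) x' (v s)) (w s)
      = (2 * (x s \<bullet> x') / (x s \<bullet> x s)) *\<^sub>R herm (v s) (w s)"
    using herm_hopf_christoffel[OF x(2), of x' "v s" "w s"]
    by (simp add: herm.minus_left herm.minus_right)
      (metis (no_types, lifting) add.commute minus_add_distrib minus_minus uminus_add_conv_diff)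
  ultimately show ?thesis
    by (simp add: divide_inverse mult_ac)
qed

text \<open>The exponent at \<open>s\<close> equals
  \<open>ln (norm (\<delta> s) / norm (\<gamma> s)) / ln lam\<close>, a continuous function of
  \<open>s\<close> with integer values, hence constant on a connected set.\<close>

lemma hopf_lifts_differ_by_constant:
  fixes \<gamma> \<delta> :: "real \<Rightarrow> complex^'n"
  assumes "lam > 1" "connected I" "continuous_on I \<gamma>" "continuous_on I \<delta>"
    and "\<And>s. s \<in> I \<Longrightarrow> \<gamma> s \<noteq> 0" "\<And>s. s \<in> I \<Longrightarrow> hopf_proj lam (\<gamma> s) = hopf_proj lam (\<delta> s)"
  shows "\<exists>k. \<forall>s\<in>I. \<delta> s = (lam powi k) *\<^sub>R \<gamma> s"
proof -
  from assms(1,6) have "\<forall>s\<in>I. \<exists>k. \<delta> s = (lam powi k) *\<^sub>R \<gamma> s"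
    by (simp add: hopf_proj_eq_iff)
  then obtain k where k: "\<delta> s = (lam powi k s) *\<^sub>R \<gamma> s" if "s \<in> I" for s
    by metis
  have ln: "ln (norm (\<delta> s) / norm (\<gamma> s)) / ln lam = of_int (k s)" if "s \<in> I" for s
    using assms(1,5) that by (simp add: k powr_real_of_int' [symmetric] ln_powr)
  have "\<delta> s \<noteq> 0" if "s \<in> I" for s
    using assms(1,5) that by (simp add: k)
  then have "continuous_on I (\<lambda>s. ln (norm (\<delta> s) / norm (\<gamma> s)) / ln lam)"
    using assms by (intro continuous_intros) auto
  then have "continuous_on I (\<lambda>s. of_int (k s) :: real)"
    by (rule continuous_on_eq) (simp add: ln)
  then have "(\<lambda>s. of_int (k s) :: real) constant_on I"
  proof (rule continuous_discrete_range_constant[OF assms(2)])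
    fix s
    show "\<exists>e>0. \<forall>y. y \<in> I \<and> real_of_int (k y) \<noteq> real_of_int (k s) \<longrightarrow>
        e \<le> norm (real_of_int (k y) - real_of_int (k s))"
      by (intro exI[of _ 1]) (auto simp flip: of_int_diff of_int_abs)
  qed
  then obtain r where "\<And>s. s \<in> I \<Longrightarrow> of_int (k s) = (r :: real)"
    by (auto simp: constant_on_def)
  then have "\<forall>s\<in>I. k s = \<lfloor>r\<rfloor>"
    by (metis floor_of_int)
  with k show ?thesis
    by metis
qed

text \<open>Invariance under dilations. The last slot is left unscaled because linearity in
  \<open>v\<close> handles it separately; this form transfers the parallel transport equation from
  one lift to another.\<close>

lemma hopf_christoffel_homogeneous:
  assumes "r \<noteq> 0"
  shows "hopf_christoffel (r *\<^sub>R x) (r *\<^sub>R u) v = hopf_christoffel x u v"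
proof -
  have "inverse r * (inverse r * (r * r)) = 1"
    using assms by (simp add: field_simps)
  then show ?thesis
    by (simp add: hopf_christoffel_def herm.scaleR_left herm.scaleR_right smult.scaleR_left
        smult.scaleR_right mult_ac flip: scaleR_diff_right)
qed

lemma hopf_pairing_locally_constant:
  assumes lam: "lam > 1" and "a < b" and V: "hopf_parallel_on lam a b c V"
    and W: "hopf_parallel_on lam a b c W" and t: "t \<in> {a..b}"
  shows "\<exists>\<epsilon>>0. \<forall>s\<in>{a..b} \<inter> ball t \<epsilon>. hopf_pairing (V s) (W s) = hopf_pairing (V t) (W t)"
proof -
  from bspec[OF V[unfolded hopf_parallel_on_iff[OF \<open>a < b\<close>]] t] obtain \<epsilon>1 \<gamma> \<gamma>' v where
    \<gamma>: "\<epsilon>1 > 0" "\<And>s. s \<in> {a..b} \<inter> ball t \<epsilon>1 \<Longrightarrow>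
        \<gamma> s \<noteq> 0 \<and> c s = hopf_proj lam (\<gamma> s) \<and> V s = hopf_tproj lam (\<gamma> s) (v s) \<and>
        (\<gamma> has_vector_derivative \<gamma>' s) (at s within {a..b}) \<and>
        (v has_vector_derivative - hopf_christoffel (\<gamma> s) (\<gamma>' s) (v s)) (at s within {a..b})"
    by blast
  from bspec[OF W[unfolded hopf_parallel_on_iff[OF \<open>a < b\<close>]] t] obtain \<epsilon>2 \<delta> \<delta>' w where
    \<delta>: "\<epsilon>2 > 0" "\<And>s. s \<in> {a..b} \<inter> ball t \<epsilon>2 \<Longrightarrow>
        \<delta> s \<noteq> 0 \<and> c s = hopf_proj lam (\<delta> s) \<and> W s = hopf_tproj lam (\<delta> s) (w s) \<and>
        (\<delta> has_vector_derivative \<delta>' s) (at s within {a..b}) \<and>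
        (w has_vector_derivative - hopf_christoffel (\<delta> s) (\<delta>' s) (w s)) (at s within {a..b})"
    by blast
  define \<epsilon> where "\<epsilon> = min \<epsilon>1 \<epsilon>2"
  define I where "I = {a..b} \<inter> ball t \<epsilon>"
  have I: "s \<in> {a..b}" "s \<in> {a..b} \<inter> ball t \<epsilon>1" "s \<in> {a..b} \<inter> ball t \<epsilon>2"
    "at s within {a..b} = at s within I" if "s \<in> I" for s
    using that at_within_Int_ball[of s t \<epsilon> "{a..b}"] by (auto simp: I_def \<epsilon>_def)
  have conv: "convex I"
    by (auto simp: I_def intro: convex_Int)
  have "continuous_on I \<gamma>" "continuous_on I \<delta>"
    using \<gamma>(2)[OF I(2)] \<delta>(2)[OF I(3)] I(4)
    by (auto simp: continuous_on_eq_continuous_within intro!: has_vector_derivative_continuous)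
  from hopf_lifts_differ_by_constant[OF lam convex_connected[OF conv] this]
  obtain k where k: "\<And>s. s \<in> I \<Longrightarrow> \<delta> s = (lam powi k) *\<^sub>R \<gamma> s"
    using \<gamma>(2)[OF I(2)] \<delta>(2)[OF I(3)] by metis
  \<comment> \<open>From here on both fields are referred to the lift \<open>\<gamma>\<close>:
    dividing \<open>w\<close> by \<open>r\<close> moves the representative from foot
    \<open>\<delta> s\<close> to foot \<open>\<gamma> s\<close> without changing the tangent
    vector.\<close>
  define r where "r = lam powi k"
  have r: "r \<noteq> 0"
    using lam by (simp add: r_def)
  have pairing: "hopf_pairing (V s) (W s) = herm (v s) (w s /\<^sub>R r) /\<^sub>R (\<gamma> s \<bullet> \<gamma> s)" if s: "s \<in> I" for s
  proof -
    have "W s = hopf_tproj lam (r *\<^sub>R \<gamma> s) (r *\<^sub>R (w s /\<^sub>R r))"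
      using \<delta>(2)[OF I(3)[OF s]] k[OF s] r by (simp add: r_def)
    also have "\<dots> = hopf_tproj lam (\<gamma> s) (w s /\<^sub>R r)"
      using hopf_tproj_eq_iff[OF lam] unfolding r_def by metis
    finally show ?thesis
      using \<gamma>(2)[OF I(2)[OF s]] hopf_pairing_hopf_tproj[OF lam, of "\<gamma> s" "v s" "w s /\<^sub>R r"]
      by simp
  qed
  have "((\<lambda>s. herm (v s) (w s /\<^sub>R r) /\<^sub>R (\<gamma> s \<bullet> \<gamma> s)) has_vector_derivative 0) (at s within I)"
    if s: "s \<in> I" for s
  proof (rule parallel_herm_derivative)
    note g = \<gamma>(2)[OF I(2)[OF s]] and d = \<delta>(2)[OF I(3)[OF s]]
    show x: "(\<gamma> has_vector_derivative \<gamma>' s) (at s within I)" and "\<gamma> s \<noteq> 0"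
      "(v has_vector_derivative - hopf_christoffel (\<gamma> s) (\<gamma>' s) (v s)) (at s within I)"
      using g I(4)[OF s] by auto
    have "((\<lambda>s. r *\<^sub>R \<gamma> s) has_vector_derivative r *\<^sub>R \<gamma>' s) (at s within I)"
      using x by (rule bounded_linear.has_vector_derivative[OF bounded_linear_scaleR_right])
    then have "(\<delta> has_vector_derivative r *\<^sub>R \<gamma>' s) (at s within I)"
      by (rule has_vector_derivative_transform[OF s, rotated]) (simp add: k r_def)
    then have \<delta>': "\<delta>' s = r *\<^sub>R \<gamma>' s"
      using vector_derivative_unique_within_closed_interval[of a b s \<delta> "\<delta>' s" "r *\<^sub>R \<gamma>' s"]
        d I(1,4)[OF s] \<open>a < b\<close> by simp
    have "((\<lambda>s. w s /\<^sub>R r) has_vector_derivative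
        (- hopf_christoffel (\<delta> s) (\<delta>' s) (w s)) /\<^sub>R r) (at s within I)"
      using d I(4)[OF s] bounded_linear.has_vector_derivative[OF bounded_linear_scaleR_right] by metis
    moreover have "hopf_christoffel (\<delta> s) (\<delta>' s) (w s) = hopf_christoffel (\<gamma> s) (\<gamma>' s) (w s)"
      unfolding \<delta>' k[OF s] using hopf_christoffel_homogeneous[OF r] by (simp add: r_def)
    moreover have "(- hopf_christoffel (\<gamma> s) (\<gamma>' s) (w s)) /\<^sub>R r
        = - hopf_christoffel (\<gamma> s) (\<gamma>' s) (w s /\<^sub>R r)"
      by (simp add: scaleR_vec_eq_smult hopf_christoffel_smult_right smult.minus_right)
    ultimately show "((\<lambda>s. w s /\<^sub>R r) has_vector_derivative
        - hopf_christoffel (\<gamma> s) (\<gamma>' s) (w s /\<^sub>R r)) (at s within I)"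
      by simp
  qed
  from has_vector_derivative_zero_constant[OF conv this]
  obtain z where "\<And>s. s \<in> I \<Longrightarrow> herm (v s) (w s /\<^sub>R r) /\<^sub>R (\<gamma> s \<bullet> \<gamma> s) = z"
    by blast
  moreover have "\<epsilon> > 0" "t \<in> I"
    using \<gamma>(1) \<delta>(1) t by (auto simp: \<epsilon>_def I_def)
  ultimately show ?thesis
    using pairing unfolding I_def by metis
qed

section \<open>From local to global constancy of the pairing\<close>

lemma subdivision_right:
  assumes "subdivision N p" "0 \<le> t" "t < 1"
  shows "\<exists>i<N. p i \<le> t \<and> t < p (Suc i)"
proof -
  define j where "j = (LEAST j. t < p j)"
  have ex: "t < p N"
    using assms by (simp add: subdivision_def)
  then have j: "t < p j" "j \<le> N"
    unfolding j_def by (auto intro: LeastI Least_le)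
  have "j \<noteq> 0"
    using j(1) assms by (auto simp: subdivision_def intro: ccontr)
  moreover from this have "\<not> t < p (j - 1)"
    unfolding j_def using not_less_Least[of "j - 1" "\<lambda>j. t < p j"] by (simp add: j_def)
  ultimately show ?thesis
    using j by (intro exI[of _ "j - 1"]) auto
qed

text \<open>The difference from \<open>subdivision_right\<close> shows at break points: searching
  with \<open>\<le>\<close> finds the piece that ends at \<open>t\<close>, searching with
  \<open><\<close> the one that begins there.\<close>

lemma subdivision_left:
  assumes "subdivision N p" "0 < t" "t \<le> 1"
  shows "\<exists>i<N. p i < t \<and> t \<le> p (Suc i)"
proof -
  define j where "j = (LEAST j. t \<le> p j)"
  have ex: "t \<le> p N"
    using assms by (simp add: subdivision_def)
  then have j: "t \<le> p j" "j \<le> N"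
    unfolding j_def by (auto intro: LeastI Least_le)
  have "j \<noteq> 0"
    using j(1) assms by (auto simp: subdivision_def intro: ccontr)
  moreover from this have "\<not> t \<le> p (j - 1)"
    unfolding j_def using not_less_Least[of "j - 1" "\<lambda>j. t \<le> p j"] by (simp add: j_def)
  ultimately show ?thesis
    using j by (intro exI[of _ "j - 1"]) auto
qed

text \<open>Near each \<open>t\<close> one piece of \<open>V\<close> and one piece of
  \<open>W\<close> overlap on a nondegenerate interval, on the right and on the left separately.
  This makes the pairing locally constant on \<open>{0..1}\<close>, and connectedness equates the
  values at the ends.\<close>

lemma hopf_pairing_parallel_const:
  assumes lam: "lam > 1" and V: "hopf_parallel lam c V" and W: "hopf_parallel lam c W"
  shows "hopf_pairing (V 1) (W 1) = hopf_pairing (V 0) (W 0)"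
proof -
  define F where "F s = hopf_pairing (V s) (W s)" for s
  obtain N p where p: "subdivision N p" "\<And>i. i < N \<Longrightarrow> hopf_parallel_on lam (p i) (p (Suc i)) c V"
    using V by (auto simp: hopf_parallel_def)
  obtain M q where q: "subdivision M q" "\<And>i. i < M \<Longrightarrow> hopf_parallel_on lam (q i) (q (Suc i)) c W"
    using W by (auto simp: hopf_parallel_def)
  have right: "\<exists>\<epsilon>>0. \<forall>s. t \<le> s \<and> s < t + \<epsilon> \<longrightarrow> F s = F t" if t: "0 \<le> t" "t < 1" for t
  proof -
    obtain i j where ij: "i < N" "p i \<le> t" "t < p (Suc i)" "j < M" "q j \<le> t" "t < q (Suc j)"
      using subdivision_right[OF p(1) t] subdivision_right[OF q(1) t] by blast
    define b where "b = min (p (Suc i)) (q (Suc j))"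
    have b: "t < b" "b \<le> p (Suc i)" "b \<le> q (Suc j)"
      using ij by (auto simp: b_def)
    have "\<exists>\<epsilon>>0. \<forall>s\<in>{t..b} \<inter> ball t \<epsilon>. F s = F t"
      unfolding F_def
      by (rule hopf_pairing_locally_constant[OF lam b(1)
          hopf_parallel_on_subinterval[OF p(2)[OF ij(1)] ij(2) b(1,2)]
          hopf_parallel_on_subinterval[OF q(2)[OF ij(4)] ij(5) b(1,3)]]) (use b(1) in simp)
    then obtain \<epsilon> where \<epsilon>: "\<epsilon> > 0" "\<forall>s\<in>{t..b} \<inter> ball t \<epsilon>. F s = F t"
      by blast
    have "F s = F t" if "t \<le> s" "s < t + min \<epsilon> (b - t)" for s
      by (rule bspec[OF \<epsilon>(2)]) (use that in \<open>auto simp: dist_real_def\<close>)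
    moreover have "min \<epsilon> (b - t) > 0"
      using \<epsilon>(1) b(1) by simp
    ultimately show ?thesis
      by blast
  qed
  have left: "\<exists>\<epsilon>>0. \<forall>s. t - \<epsilon> < s \<and> s \<le> t \<longrightarrow> F s = F t" if t: "0 < t" "t \<le> 1" for t
  proof -
    obtain i j where ij: "i < N" "p i < t" "t \<le> p (Suc i)" "j < M" "q j < t" "t \<le> q (Suc j)"
      using subdivision_left[OF p(1) t] subdivision_left[OF q(1) t] by blast
    define b where "b = max (p i) (q j)"
    have b: "b < t" "p i \<le> b" "q j \<le> b"
      using ij by (auto simp: b_def)
    have "\<exists>\<epsilon>>0. \<forall>s\<in>{b..t} \<inter> ball t \<epsilon>. F s = F t"
      unfolding F_def
      by (rule hopf_pairing_locally_constant[OF lam b(1)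
          hopf_parallel_on_subinterval[OF p(2)[OF ij(1)] b(2,1) ij(3)]
          hopf_parallel_on_subinterval[OF q(2)[OF ij(4)] b(3,1) ij(6)]]) (use b(1) in simp)
    then obtain \<epsilon> where \<epsilon>: "\<epsilon> > 0" "\<forall>s\<in>{b..t} \<inter> ball t \<epsilon>. F s = F t"
      by blast
    have "F s = F t" if "t - min \<epsilon> (t - b) < s" "s \<le> t" for s
      by (rule bspec[OF \<epsilon>(2)]) (use that in \<open>auto simp: dist_real_def\<close>)
    moreover have "min \<epsilon> (t - b) > 0"
      using \<epsilon>(1) b(1) by simp
    ultimately show ?thesis
      by blast
  qed
  have "\<forall>\<^sub>F s in at t within {0..1}. F t = F s" if t: "t \<in> {0..1}" for t
  proof -
    \<comment> \<open>At an end point of \<open>{0..1}\<close> one side is vacuous; its radius is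
      set to 1.\<close>
    obtain \<epsilon>1 where e1: "\<epsilon>1 > 0" "t < 1 \<longrightarrow> (\<forall>s. t \<le> s \<and> s < t + \<epsilon>1 \<longrightarrow> F s = F t)"
      using right[of t] t by (cases "t < 1") (auto intro: that[of 1])
    obtain \<epsilon>2 where e2: "\<epsilon>2 > 0" "0 < t \<longrightarrow> (\<forall>s. t - \<epsilon>2 < s \<and> s \<le> t \<longrightarrow> F s = F t)"
      using left[of t] t by (cases "0 < t") (auto intro: that[of 1])
    have "F t = F s" if "s \<in> {0..1}" "s \<noteq> t" "dist s t < min \<epsilon>1 \<epsilon>2" for s
    proof (cases "s < t")
      case True
      then show ?thesis
        using that t by (intro e2(2)[rule_format, symmetric]) (auto simp: dist_real_def)
    next
      case False
      then show ?thesis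
        using that t by (intro e1(2)[rule_format, symmetric]) (auto simp: dist_real_def)
    qed
    then show ?thesis
      using e1(1) e2(1) unfolding eventually_at by (intro exI[of _ "min \<epsilon>1 \<epsilon>2"]) auto
  qed
  then have "F 0 = F 1"
    using connected_local_const[of "{0..1::real}" 0 1 F] by simp
  then show ?thesis
    by (simp add: F_def)
qed

section \<open>The radial field and the upper bound for the holonomy\<close>

lemma hopf_christoffel_radial: "x \<noteq> 0 \<Longrightarrow> hopf_christoffel x u x = - u"
  by (simp add: hopf_christoffel_def herm_self power2_norm_eq_inner flip: scaleR_vec_eq_smult)

text \<open>In a lift the field is \<open>\<gamma>\<close> itself, and
  \<open>\<gamma>' = - hopf_christoffel \<gamma> \<gamma>' \<gamma>\<close> by
  \<open>hopf_christoffel_radial\<close>. Taking the diagonal of the orbit \<open>c s\<close>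
  describes it independently of the lift, hence along the whole loop.\<close>

lemma hopf_parallel_radial:
  assumes "hopf_loop lam m c"
  shows "hopf_parallel lam c (\<lambda>s. (\<lambda>y. (y, y)) ` c s)"
proof -
  obtain N p where p: "subdivision N p" "\<And>i. i < N \<Longrightarrow> hopf_smooth_curve lam (p i) (p (Suc i)) c"
    using assms by (auto simp: hopf_loop_def)
  have "hopf_parallel_on lam (p i) (p (Suc i)) c (\<lambda>s. (\<lambda>y. (y, y)) ` c s)" if "i < N" for i
    unfolding hopf_parallel_on_def
  proof
    let ?I = "{p i..p (Suc i)}"
    fix t assume "t \<in> ?I"
    from bspec[OF p(2)[OF that, unfolded hopf_smooth_curve_def] this]
    obtain \<epsilon> \<gamma> where \<gamma>: "\<epsilon> > 0" "smooth_on (?I \<inter> ball t \<epsilon>) \<gamma>"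
      "\<And>s. s \<in> ?I \<inter> ball t \<epsilon> \<Longrightarrow> \<gamma> s \<noteq> 0 \<and> c s = hopf_proj lam (\<gamma> s)"
      by blast
    have "(\<lambda>y. (y, y)) ` hopf_proj lam x = hopf_tproj lam x x" for x :: "complex^'a"
      by (auto simp: hopf_proj_def hopf_tproj_def image_iff)
    with \<gamma> smooth_on_imp_has_vector_derivative[OF \<gamma>(2)]
    show "\<exists>\<epsilon>>0. \<exists>\<gamma> v. smooth_on (?I \<inter> ball t \<epsilon>) \<gamma> \<and>
        (\<forall>s\<in>?I \<inter> ball t \<epsilon>.
           \<gamma> s \<noteq> 0 \<and> c s = hopf_proj lam (\<gamma> s) \<and> (\<lambda>y. (y, y)) ` c s = hopf_tproj lam (\<gamma> s) (v s) \<and>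
           (v has_vector_derivative
              - hopf_bismut (\<gamma> s) (vector_derivative \<gamma> (at s within ?I \<inter> ball t \<epsilon>)) (v s))
             (at s within ?I \<inter> ball t \<epsilon>))"
      by (intro exI[of _ \<epsilon>] exI[of _ \<gamma>] conjI ballI)
        (auto simp: hopf_bismut_eq hopf_christoffel_radial)
  qed
  with p(1) show ?thesis
    by (auto simp: hopf_parallel_def)
qed

text \<open>The definition of holonomy supplies some parallel field for each tangent vector, not a
  preferred one for \<open>x\<close>. Pairing these fields with each other gives the isometry
  property; pairing them with the radial field gives \<open>herm (T v) x = herm v x\<close>, and
  then \<open>T x - x\<close> has length 0.\<close>

lemma hopf_holonomy_unitary:
  assumes lam: "lam > 1" and x: "x \<noteq> 0" and P: "P \<in> hopf_holonomy lam (hopf_proj lam x)"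
  shows "\<exists>T. (\<forall>v. P (hopf_tproj lam x v) = hopf_tproj lam x (T v)) \<and>
    (\<forall>v w. herm (T v) (T w) = herm v w) \<and> T x = x"
proof -
  let ?m = "hopf_proj lam x"
  obtain c where PiE: "P \<in> hopf_tangent lam ?m \<rightarrow>\<^sub>E hopf_tangent lam ?m" and c: "hopf_loop lam ?m c"
    and V: "\<And>\<xi>. \<xi> \<in> hopf_tangent lam ?m \<Longrightarrow> \<exists>V. hopf_parallel lam c V \<and> V 0 = \<xi> \<and> V 1 = P \<xi>"
    using P by (auto simp: hopf_holonomy_def)
  have "\<exists>w. P (hopf_tproj lam x v) = hopf_tproj lam x w" for v
    using PiE by (auto simp: hopf_tangent_hopf_proj[OF lam] PiE_def Pi_def)
  then obtain T where T: "P (hopf_tproj lam x v) = hopf_tproj lam x (T v)" for v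
    by metis
  have V: "\<exists>V. hopf_parallel lam c V \<and> V 0 = hopf_tproj lam x v \<and> V 1 = hopf_tproj lam x (T v)" for v
    using V[of "hopf_tproj lam x v"] by (auto simp: hopf_tangent_hopf_proj[OF lam] T)
  have herm: "herm (T v) (T w) = herm v w" for v w
  proof -
    obtain V where v: "hopf_parallel lam c V" "V 0 = hopf_tproj lam x v" "V 1 = hopf_tproj lam x (T v)"
      using V by blast
    obtain W where w: "hopf_parallel lam c W" "W 0 = hopf_tproj lam x w" "W 1 = hopf_tproj lam x (T w)"
      using V by blast
    from hopf_pairing_parallel_const[OF lam v(1) w(1)] v w x show ?thesis
      by (simp add: hopf_pairing_hopf_tproj[OF lam x])
  qed
  have "c 0 = ?m" "c 1 = ?m"
    using c by (auto simp: hopf_loop_def)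
  have radial: "(\<lambda>y. (y, y)) ` ?m = hopf_tproj lam x x"
    by (auto simp: hopf_proj_def hopf_tproj_def image_iff)
  have herm_x: "herm (T v) x = herm v x" for v
  proof -
    obtain V where "hopf_parallel lam c V"
      "V 0 = hopf_tproj lam x v" "V 1 = hopf_tproj lam x (T v)"
      using V by blast
    with hopf_pairing_parallel_const[OF lam this(1) hopf_parallel_radial[OF c]] x show ?thesis
      by (simp add: \<open>c 0 = ?m\<close> \<open>c 1 = ?m\<close> radial hopf_pairing_hopf_tproj[OF lam x])
  qed
  have "herm x (T x) = herm x x"
    using cnj_herm[of "T x" x] cnj_herm[of x x] herm_x[of x] by simp
  then have "herm (T x - x) (T x - x) = 0"
    by (simp add: herm_simps herm herm_x)
  then have "T x = x"
    by simp
  with T herm show ?thesis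
    by blast
qed

section \<open>Explicit loops\<close>

lemma has_vector_derivative_cis_affine:
  "((\<lambda>t. cis (w * (t - a))) has_vector_derivative \<i> * of_real w * cis (w * (t - a))) (at t within S)"
  unfolding has_vector_derivative_def
  by (auto intro!: derivative_eq_intros
      simp: fun_eq_iff scaleR_conv_of_real[where 'a=complex] algebra_simps)

text \<open>In the basis \<open>x\<close>, \<open>u\<close> the vector \<open>y\<close> and the
  vector in the first conclusion have coordinates \<open>(\<alpha>, \<beta>)\<close> and
  \<open>(- cnj \<beta>, cnj \<alpha>)\<close>, the columns of a matrix in SU(2). When
  \<open>\<alpha>'\<close>, \<open>\<beta>'\<close> are the derivatives, that conclusion says that
  the second column is parallel. On the complement of the plane the connection acts through the
  scalar \<open>herm y y' / (x \<bullet> x)\<close>.\<close>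

lemma hopf_christoffel_sphere:
  fixes x u w :: "complex^'n" and \<alpha> \<beta> \<alpha>' \<beta>' :: complex
  assumes x: "x \<noteq> 0" and u: "herm u x = 0" "herm u u = herm x x"
    and c: "\<alpha> * cnj \<alpha> + \<beta> * cnj \<beta> = 1"
  defines "y \<equiv> \<alpha> *s x + \<beta> *s u" and "y' \<equiv> \<alpha>' *s x + \<beta>' *s u"
  shows "hopf_christoffel y y' (- cnj \<beta> *s x + cnj \<alpha> *s u) = cnj \<beta>' *s x - cnj \<alpha>' *s u" (is ?A)
    and "herm w x = 0 \<Longrightarrow> herm w u = 0 \<Longrightarrow>
      hopf_christoffel y y' w = - (\<alpha> * cnj \<alpha>' + \<beta> * cnj \<beta>') *s w"
    and "y \<noteq> 0"
proof -
  have xu: "herm x u = 0"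
    using u(1) cnj_herm[of u x] by simp
  have hx: "herm x x = of_real (x \<bullet> x)"
    by (simp add: herm_self power2_norm_eq_inner)
  have "herm y y = herm x x * (\<alpha> * cnj \<alpha> + \<beta> * cnj \<beta>)"
    by (simp add: y_def herm_simps u xu algebra_simps)
  then have yy: "y \<bullet> y = x \<bullet> x"
    by (simp add: c inner_eq_Re_herm)
  with x show "y \<noteq> 0"
    by auto
  let ?P = "- cnj \<beta> * cnj \<alpha>' + cnj \<alpha> * cnj \<beta>'" and ?Q = "\<alpha> * cnj \<alpha>' + \<beta> * cnj \<beta>'"
  let ?v = "- cnj \<beta> *s x + cnj \<alpha> *s u"
  have Q: "herm y y' = of_real (x \<bullet> x) * ?Q"
    by (simp add: y_def y'_def herm_simps u xu algebra_simps flip: hx)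
  have P: "herm ?v y' = of_real (x \<bullet> x) * ?P" "herm ?v y = 0"
    by (simp_all add: y_def y'_def herm_simps u xu algebra_simps flip: hx)
  have scale: "of_real r * d *s z = r *\<^sub>R (d *s z)" for r d and z :: "complex^'n"
    by (simp add: scaleR_vec_eq_smult vector_smult_assoc)
  have "hopf_christoffel y y' ?v = ?P *s y - ?Q *s ?v"
    unfolding hopf_christoffel_def P Q yy scale scaleR_diff_right[symmetric]
    using x by simp
  also have "\<dots> = (cnj \<beta>' * (\<alpha> * cnj \<alpha> + \<beta> * cnj \<beta>)) *s x - (cnj \<alpha>' * (\<alpha> * cnj \<alpha> + \<beta> * cnj \<beta>)) *s u"
    by (simp add: y_def vec_eq_iff algebra_simps)
  finally show ?A
    by (simp only: c mult_1_right)
  assume w: "herm w x = 0" "herm w u = 0"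
  have "herm w y' = 0" "herm w y = 0"
    using w by (simp_all add: y_def y'_def herm_simps)
  then have "hopf_christoffel y y' w = (- (of_real (x \<bullet> x) * ?Q *s w)) /\<^sub>R (x \<bullet> x)"
    by (simp add: hopf_christoffel_def Q yy)
  also have "\<dots> = - ?Q *s w"
    unfolding scale using x by (simp add: smult.minus_left)
  finally show "hopf_christoffel y y' w = - ?Q *s w" .
qed

text \<open>For \<open>u\<close> orthogonal to \<open>x\<close> and of the same length, this is the
  identity on the span of \<open>x\<close> and \<open>u\<close> and multiplication by
  \<open>\<mu>\<close> on its complement; the equal lengths allow one denominator for both
  projections.\<close>

definition loop_map :: "complex^'n \<Rightarrow> complex^'n \<Rightarrow> complex \<Rightarrow> complex^'n \<Rightarrow> complex^'n" where
  "loop_map x u \<mu> v = \<mu> *s v + ((1 - \<mu>) / herm x x) *s (herm v x *s x + herm v u *s u)"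

lemma hopf_christoffel_add_right:
  "hopf_christoffel x u (v + w) = hopf_christoffel x u v + hopf_christoffel x u w"
  by (simp add: hopf_christoffel_def herm_simps vec_eq_iff algebra_simps)

text \<open>
  The loop is a circle through \<open>x\<close> in the sphere of \<open>span\<^sub>\<complex>(x, u)\<close>. On that 2-plane the Bismut
  connection is the flat one of \<open>S\<^sup>1 \<times> S\<^sup>3\<close>; on the complement it is a connection on a trivial line
  bundle, whose holonomy depends on the radius of the circle.
\<close>

lemma circle_transport:
  fixes x u :: "complex^'n"
  assumes x: "x \<noteq> 0" and u: "herm u x = 0" "herm u u = herm x x"
    and \<mu>: "norm \<mu> = 1" and ab: "a < b"
  shows "\<exists>\<gamma> \<gamma>'. (\<forall>S. smooth_on S \<gamma>) \<and> \<gamma> a = x \<and> \<gamma> b = x \<and>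
    (\<forall>t. \<gamma> t \<noteq> 0 \<and> (\<gamma> has_vector_derivative \<gamma>' t) (at t)) \<and>
    (\<forall>w. \<exists>v. v a = w \<and> v b = loop_map x u \<mu> w \<and>
       (\<forall>t. (v has_vector_derivative - hopf_christoffel (\<gamma> t) (\<gamma>' t) (v t)) (at t)))"
proof -
  \<comment> \<open>The complement will turn clockwise, by the factor
    \<open>cis (- 2 * pi * p)\<close>, so the angle is read off from
    \<open>cnj \<mu>\<close>.\<close>
  have "norm (cnj \<mu>) = 1"
    using \<mu> by simp
  from complex_unimodular_polar[OF this] obtain \<theta> where
    \<theta>: "0 \<le> \<theta>" "\<theta> < 2 * pi" "cnj \<mu> = Complex (cos \<theta>) (sin \<theta>)"
    by metis
  have \<mu>': "\<mu> = cis (- \<theta>)"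
    using \<theta>(3) by (simp add: complex_eq_iff)
  define p where "p = \<theta> / (2 * pi)"
  have p: "0 \<le> p" "p \<le> 1" "2 * pi * p = \<theta>"
    using \<theta> by (auto simp: p_def)
  \<comment> \<open>This value makes the centre \<open>(1 - p) *s x - k *s u\<close> of the circle
    orthogonal to its radius vector \<open>p *s x + k *s u\<close>, which keeps the circle on the
    sphere. The squared radius is the fraction \<open>p\<close> of \<open>herm x x\<close>.\<close>
  define k where "k = sqrt (p * (1 - p))"
  have k: "k * k = p * (1 - p)"
    using p by (simp add: k_def)
  define \<omega> where "\<omega> = 2 * pi / (b - a)"
  have \<omega>: "\<omega> * (b - a) = 2 * pi"
    using ab by (simp add: \<omega>_def)
  define e where "e t = cis (\<omega> * (t - a))" for t
  have e: "(e has_vector_derivative \<i> * of_real \<omega> * e t) (at t)" for t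
    unfolding e_def by (rule has_vector_derivative_cis_affine)
  have ee: "e t * cnj (e t) = 1" for t
    by (simp add: e_def cis_cnj cis_mult)
  define \<alpha> where "\<alpha> t = of_real p * e t + of_real (1 - p)" for t
  define \<beta> where "\<beta> t = of_real k * e t - of_real k" for t
  define \<alpha>' where "\<alpha>' t = of_real p * (\<i> * of_real \<omega> * e t)" for t
  define \<beta>' where "\<beta>' t = of_real k * (\<i> * of_real \<omega> * e t)" for t
  have d\<alpha>: "(\<alpha> has_vector_derivative \<alpha>' t) (at t)" and d\<beta>: "(\<beta> has_vector_derivative \<beta>' t) (at t)" for t
    unfolding \<alpha>_def \<beta>_def \<alpha>'_def \<beta>'_def using e[of t] by (auto intro!: derivative_eq_intros)
  have k2: "of_real k * of_real k = (of_real p * (1 - of_real p) :: complex)"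
    by (metis k of_real_1 of_real_diff of_real_mult)
  have unit: "\<alpha> t * cnj (\<alpha> t) + \<beta> t * cnj (\<beta> t) = 1" for t
  proof -
    have "\<alpha> t * cnj (\<alpha> t) + \<beta> t * cnj (\<beta> t) =
      of_real p * of_real p * (e t * cnj (e t)) + of_real p * (1 - of_real p) * (e t + cnj (e t))
      + (1 - of_real p) * (1 - of_real p)
      + of_real k * of_real k * (e t * cnj (e t) - (e t + cnj (e t)) + 1)"
      by (simp add: \<alpha>_def \<beta>_def algebra_simps)
    also have "\<dots> = 1"
      unfolding k2 ee by (simp add: algebra_simps)
    finally show ?thesis .
  qed
  \<comment> \<open>The velocity is \<open>\<i> * \<omega>\<close> times the rotating part of the
    curve, and that part is orthogonal to the centre. Hence the rate does not depend on
    \<open>t\<close>, and the equation on the complement is solved by an exponential.\<close>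
  have rate: "\<alpha> t * cnj (\<alpha>' t) + \<beta> t * cnj (\<beta>' t) = - (\<i> * of_real (\<omega> * p))" for t
  proof -
    have "\<alpha> t * cnj (\<alpha>' t) + \<beta> t * cnj (\<beta>' t) = - (\<i> * of_real \<omega>) *
      (of_real p * of_real p * (e t * cnj (e t)) + of_real p * (1 - of_real p) * cnj (e t)
      + of_real k * of_real k * (e t * cnj (e t) - cnj (e t)))"
      by (simp add: \<alpha>_def \<beta>_def \<alpha>'_def \<beta>'_def algebra_simps)
    also have "\<dots> = - (\<i> * of_real (\<omega> * p))"
      unfolding k2 ee by (simp add: algebra_simps)
    finally show ?thesis .
  qed
  define \<gamma> where "\<gamma> t = \<alpha> t *s x + \<beta> t *s u" for t
  define \<gamma>' where "\<gamma>' t = \<alpha>' t *s x + \<beta>' t *s u" for t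
  define \<eta> where "\<eta> t = - cnj (\<beta> t) *s x + cnj (\<alpha> t) *s u" for t
  have d: "((\<lambda>t. f t *s z) has_vector_derivative f' *s z) (at t)"
    if "(f has_vector_derivative f') (at t)" for f f' t and z :: "complex^'n"
    using that by (rule bounded_linear.has_vector_derivative[OF smult.bounded_linear_left])
  have dc: "((\<lambda>t. cnj (f t)) has_vector_derivative cnj f') (at t)"
    if "(f has_vector_derivative f') (at t)" for f f' and t :: real
    using that by (rule bounded_linear.has_vector_derivative[OF bounded_linear_cnj])
  note sphere = hopf_christoffel_sphere[OF x u unit]
  have d\<gamma>: "(\<gamma> has_vector_derivative \<gamma>' t) (at t)" for t
    unfolding \<gamma>_def \<gamma>'_def by (intro has_vector_derivative_add d d\<alpha> d\<beta>)
  have d\<eta>: "(\<eta> has_vector_derivative - hopf_christoffel (\<gamma> t) (\<gamma>' t) (\<eta> t)) (at t)" for t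
  proof -
    have "(\<eta> has_vector_derivative - cnj (\<beta>' t) *s x + cnj (\<alpha>' t) *s u) (at t)"
      unfolding \<eta>_def by (intro has_vector_derivative_add has_vector_derivative_minus d dc d\<alpha> d\<beta>)
    then show ?thesis
      unfolding \<gamma>_def \<gamma>'_def \<eta>_def sphere(1) by (simp add: smult.minus_left)
  qed
  have \<gamma>0: "\<gamma> t \<noteq> 0" for t
    unfolding \<gamma>_def by (rule sphere(3))
  have e_ends: "e a = 1" "e b = 1"
    by (simp_all add: e_def \<omega>)
  have ends: "\<gamma> a = x" "\<gamma> b = x" "\<eta> a = u" "\<eta> b = u"
    by (simp_all add: \<gamma>_def \<eta>_def \<alpha>_def \<beta>_def e_ends)
  have "smooth_on S \<gamma>" for S
  proof -
    let ?B = "of_real p *s x + of_real k *s u"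
    have "\<gamma> t = (of_real (1 - p) *s x - of_real k *s u) + cos (\<omega> * (t - a)) *\<^sub>R ?B
        + sin (\<omega> * (t - a)) *\<^sub>R (\<i> *s ?B)" for t
    proof -
      have "e t = of_real (cos (\<omega> * (t - a))) + of_real (sin (\<omega> * (t - a))) * \<i>"
        by (simp add: e_def complex_eq_iff)
      then show ?thesis
        unfolding \<gamma>_def \<alpha>_def \<beta>_def scaleR_vec_eq_smult
        by (simp add: vec_eq_iff) (simp add: distrib_left distrib_right left_diff_distrib mult_ac)
    qed
    then have "\<gamma> = (\<lambda>t. (of_real (1 - p) *s x - of_real k *s u) + cos (\<omega> * (t - a)) *\<^sub>R ?B
        + sin (\<omega> * (t - a)) *\<^sub>R (\<i> *s ?B))"
      by blast
    then show ?thesis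
      by (simp only: smooth_on_trig)
  qed
  moreover have "\<exists>v. v a = w \<and> v b = loop_map x u \<mu> w \<and>
       (\<forall>t. (v has_vector_derivative - hopf_christoffel (\<gamma> t) (\<gamma>' t) (v t)) (at t))" for w
  proof -
    \<comment> \<open>The vector \<open>w\<close> is split along \<open>x\<close>, \<open>u\<close>
      and the complement. The parallel fields starting there are \<open>\<gamma>\<close>,
      \<open>\<eta>\<close> and a rotating multiple of the fixed vector \<open>w0\<close>; the first
      two return to their initial values, so only the third acquires a phase.\<close>
    define A B where "A = herm w x / herm x x" and "B = herm w u / herm x x"
    define w0 where "w0 = w - A *s x - B *s u"
    have w0: "herm w0 x = 0" "herm w0 u = 0"
      using x u cnj_herm[of u x] by (simp_all add: w0_def A_def B_def herm_simps)
    define \<phi> where "\<phi> t = cis ((- (\<omega> * p)) * (t - a))" for t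
    define v where "v t = A *s \<gamma> t + B *s \<eta> t + \<phi> t *s w0" for t
    have "(v has_vector_derivative - hopf_christoffel (\<gamma> t) (\<gamma>' t) (v t)) (at t)" for t
    proof -
      have "(\<phi> has_vector_derivative \<i> * of_real (- (\<omega> * p)) * \<phi> t) (at t)"
        unfolding \<phi>_def by (rule has_vector_derivative_cis_affine)
      then have d\<phi>: "((\<lambda>t. \<phi> t *s w0) has_vector_derivative
          (\<i> * of_real (- (\<omega> * p)) * \<phi> t) *s w0) (at t)"
        by (rule d)
      have "hopf_christoffel (\<gamma> t) (\<gamma>' t) w0 = (\<i> * of_real (\<omega> * p)) *s w0"
        using sphere(2)[OF w0, of t "\<alpha>' t" "\<beta>' t"] unfolding rate by (simp add: \<gamma>_def \<gamma>'_def)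
      then have w: "hopf_christoffel (\<gamma> t) (\<gamma>' t) (\<phi> t *s w0) = - ((\<i> * of_real (- (\<omega> * p)) * \<phi> t) *s w0)"
        by (simp add: hopf_christoffel_smult_right vec_eq_iff)
      have s: "((\<lambda>t. c *s f t) has_vector_derivative c *s f') (at t)"
        if "(f has_vector_derivative f') (at t)" for f f' and c :: complex
        using that by (rule bounded_linear.has_vector_derivative[OF smult.bounded_linear_right])
      have "(v has_vector_derivative A *s \<gamma>' t + B *s (- hopf_christoffel (\<gamma> t) (\<gamma>' t) (\<eta> t))
          + (\<i> * of_real (- (\<omega> * p)) * \<phi> t) *s w0) (at t)"
        unfolding v_def by (intro has_vector_derivative_add s d\<gamma> d\<eta> d\<phi>)
      moreover have "hopf_christoffel (\<gamma> t) (\<gamma>' t) (v t) = - (A *s \<gamma>' t)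
          + B *s hopf_christoffel (\<gamma> t) (\<gamma>' t) (\<eta> t) - ((\<i> * of_real (- (\<omega> * p)) * \<phi> t) *s w0)"
        unfolding v_def hopf_christoffel_add_right w
        by (simp add: hopf_christoffel_smult_right hopf_christoffel_radial[OF \<gamma>0] smult.minus_right)
      ultimately show ?thesis
        by (simp add: smult.minus_right)
    qed
    moreover have "v a = w"
      by (simp add: v_def ends \<phi>_def w0_def)
    moreover have "v b = loop_map x u \<mu> w"
    proof -
      have "- (\<omega> * p) * (b - a) = - ((\<omega> * (b - a)) * p)"
        by simp
      then have "\<phi> b = \<mu>"
        using p(3) by (simp only: \<phi>_def \<mu>' \<omega>)
      then have "v b = A *s x + B *s u + \<mu> *s (w - A *s x - B *s u)"
        by (simp add: v_def ends w0_def)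
      then show ?thesis
        by (simp add: loop_map_def A_def B_def vec_eq_iff algebra_simps add_divide_distrib diff_divide_distrib)
    qed
    ultimately show ?thesis
      by blast
  qed
  ultimately show ?thesis
    using ends \<gamma>0 d\<gamma> by blast
qed

section \<open>Concatenation of circles\<close>

inductive loop_product :: "complex^'n \<Rightarrow> nat \<Rightarrow> (complex^'n \<Rightarrow> complex^'n) \<Rightarrow> bool" for x where
  zero: "loop_product x 0 (\<lambda>v. v)"
| Suc: "loop_product x N T \<Longrightarrow> herm u x = 0 \<Longrightarrow> herm u u = herm x x \<Longrightarrow> norm \<mu> = 1 \<Longrightarrow>
    loop_product x (Suc N) (\<lambda>v. loop_map x u \<mu> (T v))"

text \<open>The velocity carries the index \<open>i\<close> of the piece because one-sided
  derivatives may differ where two circles meet. Pieces of arbitrary length \<open>h\<close> let the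
  induction append a circle at the end; normalisation to \<open>{0..1}\<close> comes
  afterwards.\<close>

lemma loop_product_transport:
  fixes x :: "complex^'n"
  assumes "loop_product x N T" and x: "x \<noteq> 0" and h: "h > 0"
  shows "\<exists>\<gamma> \<gamma>'. \<gamma> 0 = x \<and> \<gamma> (real N * h) = x \<and> (\<forall>t. \<gamma> t \<noteq> 0) \<and>
    (\<forall>i<N. smooth_on {real i * h..real (Suc i) * h} \<gamma>) \<and>
    (\<forall>i<N. \<forall>t\<in>{real i * h..real (Suc i) * h}.
       (\<gamma> has_vector_derivative \<gamma>' i t) (at t within {real i * h..real (Suc i) * h})) \<and>
    (\<forall>w. \<exists>v. v 0 = w \<and> v (real N * h) = T w \<and>
       (\<forall>i<N. \<forall>t\<in>{real i * h..real (Suc i) * h}.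
          (v has_vector_derivative - hopf_christoffel (\<gamma> t) (\<gamma>' i t) (v t))
            (at t within {real i * h..real (Suc i) * h})))"
  using assms(1)
proof induction
  case zero
  show ?case
    by (intro exI[of _ "\<lambda>_. x"]) (auto simp: x)
next
  case (Suc N T u \<mu>)
  let ?I = "\<lambda>i. {real i * h..real (Suc i) * h}"
  let ?b = "real N * h"
  have "?b < real (Suc N) * h"
    using h by simp
  from circle_transport[OF x Suc.hyps(2-4) this] obtain \<delta> \<delta>' where
    \<delta>: "\<And>S. smooth_on S \<delta>" "\<delta> ?b = x" "\<delta> (real (Suc N) * h) = x" "\<And>t. \<delta> t \<noteq> 0"
      "\<And>t. (\<delta> has_vector_derivative \<delta>' t) (at t)"
    and \<delta>v: "\<And>w. \<exists>v. v ?b = w \<and> v (real (Suc N) * h) = loop_map x u \<mu> w \<and>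
       (\<forall>t. (v has_vector_derivative - hopf_christoffel (\<delta> t) (\<delta>' t) (v t)) (at t))"
    by blast
  from Suc.IH obtain \<gamma> \<gamma>' where
    \<gamma>: "\<gamma> 0 = x" "\<gamma> ?b = x" "\<And>t. \<gamma> t \<noteq> 0" "\<And>i. i < N \<Longrightarrow> smooth_on (?I i) \<gamma>"
      "\<And>i t. i < N \<Longrightarrow> t \<in> ?I i \<Longrightarrow> (\<gamma> has_vector_derivative \<gamma>' i t) (at t within ?I i)"
    and \<gamma>v: "\<And>w. \<exists>v. v 0 = w \<and> v ?b = T w \<and> (\<forall>i<N. \<forall>t\<in>?I i.
       (v has_vector_derivative - hopf_christoffel (\<gamma> t) (\<gamma>' i t) (v t)) (at t within ?I i))"
    by blast
  define \<Gamma> where "\<Gamma> t = (if t \<le> ?b then \<gamma> t else \<delta> t)" for t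
  define \<Gamma>' where "\<Gamma>' i t = (if i < N then \<gamma>' i t else \<delta>' t)" for i t
  have le: "t \<le> ?b" if "i < N" "t \<in> ?I i" for i t
  proof -
    have "real (Suc i) * h \<le> ?b"
      using that(1) h by (intro mult_right_mono) auto
    with that(2) show ?thesis
      by auto
  qed
  have old: "\<Gamma> t = \<gamma> t" if "i < N" "t \<in> ?I i" for i t
    using le[OF that] by (simp add: \<Gamma>_def)
  have new: "\<Gamma> t = \<delta> t" if "t \<in> ?I N" for t
    using that \<gamma>(2) \<delta>(2) by (auto simp: \<Gamma>_def)
  have cases: "Q i" if "\<And>i. i < N \<Longrightarrow> Q i" "Q N" "i < Suc N" for Q i
    using that less_Suc_eq by auto
  have "smooth_on (?I i) \<Gamma>" if "i < Suc N" for i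
    using that
  proof (rule cases[rotated 2])
    show "smooth_on (?I i) \<Gamma>" if "i < N" for i
      using smooth_on_cong[OF \<gamma>(4)[OF that] old[OF that]] .
    show "smooth_on (?I N) \<Gamma>"
      using smooth_on_cong[OF \<delta>(1) new] .
  qed
  moreover have "\<forall>t\<in>?I i. (\<Gamma> has_vector_derivative \<Gamma>' i t) (at t within ?I i)" if "i < Suc N" for i
    using that
  proof (rule cases[rotated 2], safe)
    fix i t assume it: "i < N" "t \<in> ?I i"
    have "(\<gamma> has_vector_derivative \<Gamma>' i t) (at t within ?I i)"
      using \<gamma>(5)[OF it] it(1) by (simp add: \<Gamma>'_def)
    then show "(\<Gamma> has_vector_derivative \<Gamma>' i t) (at t within ?I i)"
      by (rule has_vector_derivative_transform[OF it(2), rotated]) (rule old[OF it(1)])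
  next
    fix t assume t: "t \<in> ?I N"
    have "(\<delta> has_vector_derivative \<Gamma>' N t) (at t within ?I N)"
      using has_vector_derivative_at_within[OF \<delta>(5)] by (simp add: \<Gamma>'_def)
    then show "(\<Gamma> has_vector_derivative \<Gamma>' N t) (at t within ?I N)"
      by (rule has_vector_derivative_transform[OF t, rotated]) (rule new)
  qed
  moreover have "\<exists>v. v 0 = w \<and> v (real (Suc N) * h) = loop_map x u \<mu> (T w) \<and>
       (\<forall>i<Suc N. \<forall>t\<in>?I i.
          (v has_vector_derivative - hopf_christoffel (\<Gamma> t) (\<Gamma>' i t) (v t)) (at t within ?I i))" for w
  proof -
    obtain v1 where v1: "v1 0 = w" "v1 ?b = T w" "\<And>i t. i < N \<Longrightarrow> t \<in> ?I i \<Longrightarrow>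
       (v1 has_vector_derivative - hopf_christoffel (\<gamma> t) (\<gamma>' i t) (v1 t)) (at t within ?I i)"
      using \<gamma>v by blast
    obtain v2 where v2: "v2 ?b = T w" "v2 (real (Suc N) * h) = loop_map x u \<mu> (T w)"
      "\<And>t. (v2 has_vector_derivative - hopf_christoffel (\<delta> t) (\<delta>' t) (v2 t)) (at t)"
      using \<delta>v by blast
    define v where "v t = (if t \<le> ?b then v1 t else v2 t)" for t
    have vold: "v t = v1 t" if "i < N" "t \<in> ?I i" for i t
      using le[OF that] by (simp add: v_def)
    have vnew: "v t = v2 t" if "t \<in> ?I N" for t
      using that v1(2) v2(1) by (auto simp: v_def)
    have "\<forall>t\<in>?I i. (v has_vector_derivative - hopf_christoffel (\<Gamma> t) (\<Gamma>' i t) (v t)) (at t within ?I i)"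
      if "i < Suc N" for i
      using that
    proof (rule cases[rotated 2], safe)
      fix i t assume it: "i < N" "t \<in> ?I i"
      have "(v1 has_vector_derivative - hopf_christoffel (\<Gamma> t) (\<Gamma>' i t) (v t)) (at t within ?I i)"
        using v1(3)[OF it] it(1) by (simp add: \<Gamma>'_def old[OF it] vold[OF it])
      then show "(v has_vector_derivative - hopf_christoffel (\<Gamma> t) (\<Gamma>' i t) (v t)) (at t within ?I i)"
        by (rule has_vector_derivative_transform[OF it(2), rotated]) (rule vold[OF it(1)])
    next
      fix t assume t: "t \<in> ?I N"
      have "(v2 has_vector_derivative - hopf_christoffel (\<Gamma> t) (\<Gamma>' N t) (v t)) (at t within ?I N)"
        using has_vector_derivative_at_within[OF v2(3)] by (simp add: \<Gamma>'_def new[OF t] vnew[OF t])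
      then show "(v has_vector_derivative - hopf_christoffel (\<Gamma> t) (\<Gamma>' N t) (v t)) (at t within ?I N)"
        by (rule has_vector_derivative_transform[OF t, rotated]) (rule vnew)
    qed
    moreover have "v 0 = w" "v (real (Suc N) * h) = loop_map x u \<mu> (T w)"
      using v1(1) v2(2) h by (simp_all add: v_def)
    ultimately show ?thesis
      by blast
  qed
  moreover have "\<Gamma> 0 = x" "\<Gamma> (real (Suc N) * h) = x" "\<And>t. \<Gamma> t \<noteq> 0"
    using \<gamma>(1,3) \<delta>(3,4) h by (simp_all add: \<Gamma>_def)
  ultimately show ?case
    by (intro exI[of _ \<Gamma>] exI[of _ \<Gamma>']) blast
qed

lemma hopf_holonomyI_loop_product:
  fixes x :: "complex^'n"
  assumes lam: "lam > 1" and x: "x \<noteq> 0" and T: "loop_product x N T" and N: "N > 0"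
    and P: "P \<in> hopf_tangent lam (hopf_proj lam x) \<rightarrow>\<^sub>E hopf_tangent lam (hopf_proj lam x)"
    and PT: "\<And>v. P (hopf_tproj lam x v) = hopf_tproj lam x (T v)"
  shows "P \<in> hopf_holonomy lam (hopf_proj lam x)"
proof -
  define h where "h = 1 / real N"
  have h: "h > 0" "real N * h = 1"
    using N by (simp_all add: h_def)
  let ?I = "\<lambda>i. {real i * h..real (Suc i) * h}"
  from loop_product_transport[OF T x h(1)] obtain \<gamma> \<gamma>' where
    \<gamma>: "\<gamma> 0 = x" "\<gamma> 1 = x" "\<And>t. \<gamma> t \<noteq> 0" "\<And>i. i < N \<Longrightarrow> smooth_on (?I i) \<gamma>"
      "\<And>i t. i < N \<Longrightarrow> t \<in> ?I i \<Longrightarrow> (\<gamma> has_vector_derivative \<gamma>' i t) (at t within ?I i)"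
    and \<gamma>v: "\<And>w. \<exists>v. v 0 = w \<and> v 1 = T w \<and> (\<forall>i<N. \<forall>t\<in>?I i.
       (v has_vector_derivative - hopf_christoffel (\<gamma> t) (\<gamma>' i t) (v t)) (at t within ?I i))"
    unfolding h(2) by blast
  define c where "c t = hopf_proj lam (\<gamma> t)" for t
  have sub: "subdivision N (\<lambda>i. real i * h)"
    using h by (simp add: subdivision_def)
  have sm: "smooth_on (?I i \<inter> B) \<gamma>" if "i < N" for i B
    using smooth_on_subset[OF \<gamma>(4)[OF that]] by blast
  have "hopf_loop lam (hopf_proj lam x) c"
    unfolding hopf_loop_def
  proof (intro conjI exI[of _ N] exI[of _ "\<lambda>i. real i * h"] allI impI sub)
    fix i assume "i < N"
    show "hopf_smooth_curve lam (real i * h) (real (Suc i) * h) c"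
      unfolding hopf_smooth_curve_def
      by (intro ballI exI[of _ 1] conjI exI[of _ \<gamma>] sm) (simp_all add: \<open>i < N\<close> \<gamma> c_def)
  qed (simp_all add: c_def \<gamma>)
  moreover have "\<exists>V. hopf_parallel lam c V \<and> V 0 = \<xi> \<and> V 1 = P \<xi>"
    if \<xi>_mem: "\<xi> \<in> hopf_tangent lam (hopf_proj lam x)" for \<xi>
  proof -
    obtain w where \<xi>: "\<xi> = hopf_tproj lam x w"
      using \<xi>_mem by (auto simp: hopf_tangent_hopf_proj[OF lam])
    obtain v where v: "v 0 = w" "v 1 = T w" "\<And>i t. i < N \<Longrightarrow> t \<in> ?I i \<Longrightarrow>
       (v has_vector_derivative - hopf_christoffel (\<gamma> t) (\<gamma>' i t) (v t)) (at t within ?I i)"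
      using \<gamma>v by blast
    define V where "V t = hopf_tproj lam (\<gamma> t) (v t)" for t
    have "hopf_parallel_on lam (real i * h) (real (Suc i) * h) c V" if i: "i < N" for i
    proof -
      have "real i * h < real (Suc i) * h"
        using h by simp
      then show ?thesis
        unfolding hopf_parallel_on_iff[OF \<open>real i * h < real (Suc i) * h\<close>]
        by (intro ballI, rule_tac exI[of _ 1], intro conjI, simp, rule_tac exI[of _ \<gamma>],
            rule_tac exI[of _ "\<gamma>' i"], rule_tac exI[of _ v])
          (use sm[OF i] \<gamma>(3) \<gamma>(5)[OF i] v(3)[OF i] in \<open>auto simp: c_def V_def\<close>)
    qed
    with sub have "hopf_parallel lam c V"
      unfolding hopf_parallel_def by blast
    moreover have "V 0 = \<xi>" "V 1 = P \<xi>"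
      by (simp_all add: V_def \<gamma> v \<xi> PT)
    ultimately show ?thesis
      by blast
  qed
  ultimately show ?thesis
    using P by (auto simp: hopf_holonomy_def)
qed

section \<open>Generation of the unitary group by complex reflections\<close>

text \<open>The complex reflection that multiplies \<open>w\<close> by \<open>\<nu>\<close> and
  fixes the complement of \<open>w\<close>. For \<open>w = 0\<close> it degenerates to the identity,
  which covers vectors that are already in place.\<close>

definition creflect :: "complex^'n \<Rightarrow> complex \<Rightarrow> complex^'n \<Rightarrow> complex^'n" where
  "creflect w \<nu> v = v + ((\<nu> - 1) * herm v w / herm w w) *s w"

lemma cnj_herm_self [simp]: "cnj (herm w w) = herm w w"
  by (rule cnj_herm)

lemma herm_creflect:
  assumes "\<nu> * cnj \<nu> = 1"
  shows "herm (creflect w \<nu> a) (creflect w \<nu> b) = herm a b"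
proof (cases "w = 0")
  case True
  then show ?thesis
    by (simp add: creflect_def)
next
  case False
  define r where "r = herm w w"
  have r: "r \<noteq> 0" "cnj r = r"
    using False by (simp_all add: r_def)
  have "herm (creflect w \<nu> a) (creflect w \<nu> b) = herm a b
      + (\<nu> * cnj \<nu> - 1) * herm a w * herm w b / r"
    unfolding creflect_def r_def[symmetric]
    by (simp add: herm_simps cnj_herm r field_simps flip: r_def)
  with assms show ?thesis
    by simp
qed

lemma creflect_cnj_creflect:
  assumes "\<nu> * cnj \<nu> = 1"
  shows "creflect w (cnj \<nu>) (creflect w \<nu> v) = v"
proof (cases "w = 0")
  case True
  then show ?thesis
    by (simp add: creflect_def)
next
  case False
  define r where "r = herm w w"
  have r: "r \<noteq> 0"
    using False by (simp_all add: r_def)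
  have "creflect w (cnj \<nu>) (creflect w \<nu> v) = v + ((\<nu> * cnj \<nu> - 1) * herm v w / r) *s w"
    unfolding creflect_def r_def[symmetric] using r
    by (simp add: herm_simps vec_eq_iff field_simps flip: r_def)
  with assms show ?thesis
    by simp
qed

lemma creflect_linear: "creflect w \<nu> (a + b) = creflect w \<nu> a + creflect w \<nu> b" "creflect w \<nu> (c *s a) = c *s creflect w \<nu> a"
  by (simp_all add: creflect_def herm_simps vec_eq_iff algebra_simps add_divide_distrib diff_divide_distrib)

lemma creflect_fixes: "herm v w = 0 \<Longrightarrow> creflect w \<nu> v = v"
  by (simp add: creflect_def)

text \<open>With \<open>z = herm a (b - a)\<close>, equality of lengths gives
  \<open>herm (b - a) (b - a) = - (z + cnj z)\<close>. The image of \<open>a\<close> is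
  \<open>b\<close> if \<open>(\<nu> - 1) * z\<close> equals this number, whence
  \<open>\<nu> = - cnj z / z\<close>, which has modulus 1.\<close>

lemma exists_creflect:
  fixes a b :: "complex^'n"
  assumes "herm a a = herm b b"
  shows "\<exists>\<nu>. \<nu> * cnj \<nu> = 1 \<and> creflect (b - a) \<nu> a = b"
proof (cases "a = b")
  case True
  then show ?thesis
    by (intro exI[of _ 1]) (simp add: creflect_def)
next
  case False
  define z where "z = herm a (b - a)"
  have w: "herm (b - a) (b - a) = - (z + cnj z)"
    using assms by (simp add: z_def herm_simps cnj_herm)
  then have "z + cnj z \<noteq> 0"
    using False by (metis eq_iff_diff_eq_0 herm_self_eq_0_iff neg_equal_0_iff_equal)
  then have z: "z \<noteq> 0"
    by auto
  have "(- cnj z / z) * cnj (- cnj z / z) = 1"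
    using z by simp
  moreover have "(- cnj z / z - 1) * z = - (z + cnj z)"
    using z by (simp add: field_simps)
  with \<open>z + cnj z \<noteq> 0\<close> have "(- cnj z / z - 1) * z / - (z + cnj z) = 1"
    by (metis divide_self neg_equal_0_iff_equal)
  then have "creflect (b - a) (- cnj z / z) a = b"
    unfolding creflect_def w z_def[symmetric] by simp
  ultimately show ?thesis
    by blast
qed

lemma herm_expansion:
  fixes e :: "'n::finite \<Rightarrow> complex^'n"
  assumes "\<And>i j. herm (e i) (e j) = (if i = j then r else 0)"
  shows "herm (\<Sum>i\<in>UNIV. c i *s e i) (e j) = c j * r"
  by (simp add: herm.sum_left herm_simps assms if_distrib cong: if_cong)

text \<open>The standard basis, scaled to the length of \<open>x\<close>, is moved by one reflection
  that takes its member \<open>i0\<close> to \<open>x\<close>. This length makes the result unitary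
  for the metric at \<open>x\<close> and makes every other basis vector admissible as the second
  direction of a circle.\<close>

lemma exists_orthogonal_basis:
  fixes x :: "complex^'n" and i0 :: 'n
  assumes x: "x \<noteq> 0"
  shows "\<exists>e. e i0 = x \<and> (\<forall>i j. herm (e i) (e j) = (if i = j then herm x x else 0)) \<and>
    (\<forall>v. v = (\<Sum>i\<in>UNIV. (herm v (e i) / herm x x) *s e i))"
proof -
  define b where "b i = of_real (norm x) *s axis i (1 :: complex)" for i :: 'n
  have hb: "herm (b i) (b j) = (if i = j then herm x x else 0)" for i j
  proof -
    have "herm (axis i 1) v = cnj (v $ i)" for v :: "complex^'n"
      by (simp add: herm_def axis_def if_distrib[where f="\<lambda>z. z * _"] cong: if_cong)
    then show ?thesis
      by (simp add: b_def herm_simps herm_self power2_eq_square axis_def)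
  qed
  obtain \<nu> where \<nu>: "\<nu> * cnj \<nu> = 1" "creflect (x - b i0) \<nu> (b i0) = x"
    using exists_creflect[of "b i0" x] hb by auto
  define H where "H = creflect (x - b i0) \<nu>"
  define H' where "H' = creflect (x - b i0) (cnj \<nu>)"
  define e where "e i = H (b i)" for i
  have he: "herm (e i) (e j) = (if i = j then herm x x else 0)" for i j
    by (simp add: e_def H_def herm_creflect[OF \<nu>(1)] hb)
  have "v = (\<Sum>i\<in>UNIV. (herm v (e i) / herm x x) *s e i)" for v
  proof -
    have H0: "H 0 = 0"
      using creflect_linear(2)[of _ _ 0 0] by (simp add: H_def)
    have H_sum: "H (\<Sum>i\<in>I. f i *s b i) = (\<Sum>i\<in>I. f i *s e i)" if "finite I" for I f
      using that by induction (simp_all add: H0, simp_all add: H_def e_def creflect_linear)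
    have "H' v = (\<Sum>i\<in>UNIV. (H' v $ i / of_real (norm x)) *s b i)"
      using x by (simp add: vec_eq_iff b_def axis_def if_distrib cong: if_cong)
    then have "H (H' v) = (\<Sum>i\<in>UNIV. (H' v $ i / of_real (norm x)) *s e i)"
      by (metis H_sum finite)
    moreover have "H (H' v) = v"
      using creflect_cnj_creflect[of "cnj \<nu>"] \<nu>(1) by (simp add: H_def H'_def mult.commute)
    ultimately obtain c where v: "v = (\<Sum>i\<in>UNIV. c i *s e i)"
      by metis
    have "herm v (e i) / herm x x = c i" for i
      unfolding v herm_expansion[OF he] using x by simp
    with v show ?thesis
      by simp
  qed
  moreover have "e i0 = x"
    by (simp add: e_def H_def \<nu>)
  ultimately show ?thesis
    using he by blast
qed

text \<open>The squared length of the defect expands into products of images under \<open>T\<close>,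
  and these cancel just as they do for the identity map.\<close>

lemma herm_isometry_linear:
  fixes T :: "complex^'n \<Rightarrow> complex^'n"
  assumes T: "\<And>v w. herm (T v) (T w) = herm v w"
  shows "T (v + w) = T v + T w" "T (c *s v) = c *s T v"
proof -
  have "herm (T (v + w) - T v - T w) (T (v + w) - T v - T w) = 0"
    by (simp add: herm_simps T)
  then show "T (v + w) = T v + T w"
    by (simp add: diff_eq_eq add.commute)
  have "herm (T (c *s v) - c *s T v) (T (c *s v) - c *s T v) = 0"
    by (simp add: herm_simps T)
  then show "T (c *s v) = c *s T v"
    by simp
qed

lemma loop_product_comp:
  assumes "loop_product x M S" "loop_product x N T"
  shows "loop_product x (M + N) (\<lambda>v. S (T v))"
  using assms(1)
proof induction
  case zero
  show ?case
    using assms(2) by simp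
next
  case (Suc M S u \<mu>)
  from loop_product.Suc[OF Suc.IH Suc.hyps(2-4)] show ?case
    by simp
qed

lemma loop_product_loop_map:
  assumes "herm u x = 0" "herm u u = herm x x" "norm \<mu> = 1"
  shows "loop_product x 1 (loop_map x u \<mu>)"
  using loop_product.Suc[OF loop_product.zero assms] by simp

section \<open>Scalars, reflections and isometries as products of circles\<close>

definition scalar_map :: "complex^'n \<Rightarrow> complex \<Rightarrow> complex^'n \<Rightarrow> complex^'n" where
  "scalar_map x \<nu> v = \<nu> *s v + ((1 - \<nu>) * herm v x / herm x x) *s x"

lemma norm_1_root:
  assumes "norm (\<nu> :: complex) = 1" "n > 0"
  shows "\<exists>\<mu>. norm \<mu> = 1 \<and> \<mu> ^ n = \<nu>"
proof -
  obtain \<theta> where "\<nu> = cis \<theta>"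
    using complex_unimodular_polar[OF assms(1)] by (metis cis.ctr)
  moreover have "cis (\<theta> / real n) ^ n = cis (real n * (\<theta> / real n))"
    by (rule Complex.DeMoivre)
  ultimately have "cis (\<theta> / real n) ^ n = \<nu>"
    using assms(2) by simp
  then show ?thesis
    by (intro exI[of _ "cis (\<theta> / real n)"]) simp
qed

text \<open>Every circle multiplies all basis vectors by \<open>\<mu>\<close> except
  \<open>x\<close> and its own direction. Over all \<open>n - 1\<close> circles each direction is
  spared once, which explains the exponent \<open>n - 2\<close>.\<close>

lemma loop_product_scalar_map:
  fixes x :: "complex^'n" and e :: "'n \<Rightarrow> complex^'n"
  assumes n: "CARD('n) \<ge> 3" and x: "x \<noteq> 0" and e0: "e i0 = x"
    and he: "\<And>i j. herm (e i) (e j) = (if i = j then herm x x else 0)"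
    and complete: "\<And>v. v = (\<Sum>i\<in>UNIV. (herm v (e i) / herm x x) *s e i)"
    and \<nu>: "norm \<nu> = 1"
  shows "\<exists>N. loop_product x N (scalar_map x \<nu>)"
proof -
  define c where "c = herm x x"
  have c: "c \<noteq> 0"
    using x by (simp add: c_def)
  obtain \<mu> where \<mu>: "norm \<mu> = 1" "\<mu> ^ (CARD('n) - 2) = \<nu>"
    using norm_1_root[OF \<nu>, of "CARD('n) - 2"] n by auto
  have \<mu>0: "\<mu> \<noteq> 0"
    using \<mu>(1) by auto
  \<comment> \<open>The product of the circles with directions in \<open>F\<close>, in closed form:
    \<open>x\<close> is fixed, each \<open>e j\<close> with \<open>j \<in> F\<close> is multiplied
    by \<open>\<mu> ^ (card F - 1)\<close>, the remaining basis vectors by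
    \<open>\<mu> ^ card F\<close>. The term with \<open>inverse \<mu> - 1\<close> records the factor
    spared in the directions of \<open>F\<close>.\<close>
  define f where "f F v = \<mu> ^ card F *s v + ((1 - \<mu> ^ card F) * herm v x / c) *s x
    + (\<mu> ^ card F * (inverse \<mu> - 1)) *s (\<Sum>j\<in>F. (herm v (e j) / c) *s e j)" for F :: "'n set" and v
  have "\<exists>N. loop_product x N (f F)" if "finite F" "i0 \<notin> F" for F
    using that
  proof induction
    case empty
    have "f {} = (\<lambda>v. v)"
      by (simp add: f_def fun_eq_iff)
    then show ?case
      using loop_product.zero by metis
  next
    case (insert k F)
    then obtain N where N: "loop_product x N (f F)"
      by auto
    have k: "k \<noteq> i0" "k \<notin> F"
      using insert by auto
    have ek: "herm (e k) x = 0" "herm (e k) (e k) = herm x x" "herm x (e k) = 0"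
      using he[of k i0] he[of i0 k] he[of k k] k by (simp_all add: e0)
    have "herm (e j) x = 0" if "j \<in> F" for j
      using he[of j i0] insert.prems that by (auto simp: e0)
    then have "herm (\<Sum>j\<in>F. (herm v (e j) / c) *s e j) x = 0" for v
      unfolding herm.sum_left herm_smult_left by (auto intro!: sum.neutral)
    then have 1: "herm (f F v) x = herm v x" for v
      using c by (simp add: f_def herm_simps field_simps flip: c_def)
    have "herm (\<Sum>j\<in>F. (herm v (e j) / c) *s e j) (e k) = 0" for v
      unfolding herm.sum_left herm_smult_left he using k(2) by (auto intro!: sum.neutral)
    then have 2: "herm (f F v) (e k) = \<mu> ^ card F * herm v (e k)" for v
      by (simp add: f_def herm_simps ek)
    have "loop_map x (e k) \<mu> (f F v) = f (insert k F) v" for v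
    proof -
      define S where "S = (\<Sum>j\<in>F. (herm v (e j) / c) *s e j)"
      have "loop_map x (e k) \<mu> (f F v) = \<mu> *s (\<mu> ^ card F *s v + ((1 - \<mu> ^ card F) * herm v x / c) *s x
          + (\<mu> ^ card F * (inverse \<mu> - 1)) *s S) +
          ((1 - \<mu>) / c) *s (herm v x *s x + (\<mu> ^ card F * herm v (e k)) *s e k)"
        by (simp only: loop_map_def 1 2) (simp add: f_def S_def c_def)
      also have "\<dots> = (\<mu> * \<mu> ^ card F) *s v + ((1 - \<mu> * \<mu> ^ card F) * herm v x / c) *s x
          + (\<mu> * \<mu> ^ card F * (inverse \<mu> - 1)) *s ((herm v (e k) / c) *s e k + S)"
      proof -
        \<comment> \<open>In each component the claim is a polynomial identity modulo
          \<open>\<mu> * \<iota> = 1\<close>, where \<open>\<iota>\<close> stands for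
          \<open>inverse \<mu>\<close>, \<open>q\<close> for \<open>inverse c\<close>, and
          \<open>h\<close>, \<open>hk\<close> for the products of \<open>v\<close> with
          \<open>x\<close> and \<open>e k\<close>.\<close>
        have "\<mu> * (m * v' + ((1 - m) * h * q) * x' + (m * (\<iota> - 1)) * s) + ((1 - \<mu>) * q) * (h * x' + m * hk * y)
          = \<mu> * m * v' + ((1 - \<mu> * m) * h * q) * x' + (\<mu> * m * (\<iota> - 1)) * (hk * q * y + s)"
          if "\<mu> * \<iota> = 1" for m v' h q x' \<iota> s hk y :: complex
          using that by algebra
        from this[OF right_inverse[OF \<mu>0]] show ?thesis
          unfolding vec_eq_iff vector_add_component vector_smult_component divide_inverse by blast
      qed
      also have "\<dots> = f (insert k F) v"
        using insert by (simp add: f_def S_def)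
      finally show ?thesis .
    qed
    then have "loop_map x (e k) \<mu> \<circ> f F = f (insert k F)"
      by (simp add: fun_eq_iff)
    then show ?case
      using loop_product_comp[OF loop_product_loop_map[OF ek(1,2) \<mu>(1)] N] by (auto simp: comp_def)
  qed
  from this[of "- {i0}"] obtain N where N: "loop_product x N (f (- {i0}))"
    by auto
  have "f (- {i0}) v = scalar_map x \<nu> v" for v
  proof -
    have "(\<Sum>j\<in>UNIV. (herm v (e j) / c) *s e j) = (herm v x / c) *s x + (\<Sum>j\<in>- {i0}. (herm v (e j) / c) *s e j)"
      by (subst sum.remove[of UNIV i0]) (simp_all add: e0 Compl_eq_Diff_UNIV)
    with complete[of v, folded c_def]
    have "v = (herm v x / c) *s x + (\<Sum>j\<in>- {i0}. (herm v (e j) / c) *s e j)"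
      by (rule trans)
    then have S: "(\<Sum>j\<in>- {i0}. (herm v (e j) / c) *s e j) = v - (herm v x / c) *s x"
      by (metis add_diff_cancel_left')
    \<comment> \<open>The exponent is \<open>n - 1\<close>, one more than in the choice of
      \<open>\<mu>\<close>; the surplus factor cancels against \<open>inverse \<mu>\<close> in
      \<open>f\<close>.\<close>
    have "card (- {i0}) = Suc (CARD('n) - 2)"
      using n by (simp add: Compl_eq_Diff_UNIV card_Diff_singleton)
    then have p: "\<mu> ^ card (- {i0}) = \<mu> * \<nu>"
      using \<mu>(2) by simp
    show ?thesis
      unfolding f_def S p scalar_map_def c_def[symmetric]
      using \<mu>0 c by (simp add: vec_eq_iff field_simps)
  qed
  then have "f (- {i0}) = scalar_map x \<nu>"
    by (simp add: fun_eq_iff)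
  with N show ?thesis
    by metis
qed

text \<open>A circle in the direction of \<open>w\<close> with phase \<open>cnj \<mu>\<close> is
  followed by the scalar \<open>\<mu>\<close>. The two phases cancel off the span of
  \<open>x\<close> and \<open>w\<close>; both maps fix \<open>x\<close>, and \<open>w\<close>, fixed
  by the circle, is left with \<open>\<mu>\<close>.\<close>

lemma loop_product_creflect:
  fixes x w :: "complex^'n"
  assumes x: "x \<noteq> 0" and w: "herm w x = 0" and \<mu>: "norm \<mu> = 1"
    and scalar: "\<And>\<nu>. norm \<nu> = 1 \<Longrightarrow> \<exists>N. loop_product x N (scalar_map x \<nu>)"
  shows "\<exists>N. loop_product x N (creflect w \<mu>)"
proof (cases "w = 0")
  case True
  then have "creflect w \<mu> = (\<lambda>v. v)"
    by (simp add: creflect_def fun_eq_iff)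
  then show ?thesis
    using loop_product.zero by metis
next
  case False
  define u where "u = (norm x / norm w) *\<^sub>R w"
  have u: "herm u x = 0" "herm u u = herm x x" "norm (cnj \<mu>) = 1"
    using w False \<mu> by (simp_all add: u_def herm_self herm.scaleR_left)
  have uw: "herm v u *s u = (herm x x * herm v w / herm w w) *s w" for v
    using False by (simp add: u_def scaleR_vec_eq_smult herm_simps herm_self vec_eq_iff
        power2_eq_square field_simps)
  obtain N where N: "loop_product x N (scalar_map x \<mu>)"
    using scalar \<mu> by blast
  have \<mu>\<mu>: "\<mu> * cnj \<mu> = 1"
    using \<mu> by (simp add: complex_norm_square[symmetric])
  have "scalar_map x \<mu> (loop_map x u (cnj \<mu>) v) = creflect w \<mu> v" for v
  proof -
    define c where "c = herm x x"
    have c: "c \<noteq> 0"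
      using x by (simp add: c_def)
    have wc: "herm w w \<noteq> 0"
      using False by simp
    have l: "loop_map x u (cnj \<mu>) v = cnj \<mu> *s v + ((1 - cnj \<mu>) * herm v x / c) *s x
        + ((1 - cnj \<mu>) * herm v w / herm w w) *s w"
      unfolding loop_map_def uw c_def[symmetric] using c wc by (simp add: vec_eq_iff field_simps)
    have "herm (loop_map x u (cnj \<mu>) v) x = herm v x"
      unfolding l using c by (simp add: herm_simps w field_simps flip: c_def)
    then have "scalar_map x \<mu> (loop_map x u (cnj \<mu>) v) = (\<mu> * cnj \<mu>) *s v
        + ((\<mu> - \<mu> * cnj \<mu>) * herm v x / c + (1 - \<mu>) * herm v x / c) *s x
        + ((\<mu> - \<mu> * cnj \<mu>) * herm v w / herm w w) *s w"
      unfolding scalar_map_def l c_def[symmetric]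
      by (simp add: vec_eq_iff algebra_simps add_divide_distrib diff_divide_distrib)
    also have "\<dots> = creflect w \<mu> v"
      unfolding \<mu>\<mu> creflect_def by (simp add: vec_eq_iff algebra_simps diff_divide_distrib)
    finally show ?thesis .
  qed
  then have "(\<lambda>v. scalar_map x \<mu> (loop_map x u (cnj \<mu>) v)) = creflect w \<mu>"
    by (simp add: fun_eq_iff)
  then show ?thesis
    using loop_product_comp[OF N loop_product_loop_map[OF u]] by metis
qed

text \<open>Induction on a set \<open>F\<close> outside of which \<open>T\<close> fixes the basis
  vectors: each step composes \<open>T\<close> with a reflection that puts one more basis vector
  back.\<close>

lemma loop_product_isometry:
  fixes x :: "complex^'n" and e :: "'n \<Rightarrow> complex^'n"
  assumes n: "CARD('n) \<ge> 3" and x: "x \<noteq> 0" and e0: "e i0 = x"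
    and he: "\<And>i j. herm (e i) (e j) = (if i = j then herm x x else 0)"
    and complete: "\<And>v. v = (\<Sum>i\<in>UNIV. (herm v (e i) / herm x x) *s e i)"
    and T: "\<And>v w. herm (T v) (T w) = herm v w" "T x = x"
  shows "\<exists>N. loop_product x N T"
proof -
  have creflect: "\<exists>N. loop_product x N (creflect w \<mu>)" if "herm w x = 0" "norm \<mu> = 1" for w \<mu>
    using loop_product_creflect[OF x that loop_product_scalar_map[OF n x e0 he complete]] .
  have "\<forall>T. (\<forall>v w. herm (T v) (T w) = herm v w) \<longrightarrow> T x = x \<longrightarrow> (\<forall>j. j \<notin> F \<longrightarrow> T (e j) = e j) \<longrightarrow>
      (\<exists>N. loop_product x N T)" if "finite F" for F :: "'n set"
    using that
  proof induction
    case empty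
    show ?case
    proof (intro allI impI)
      fix T :: "complex^'n \<Rightarrow> complex^'n"
      assume T: "\<forall>v w. herm (T v) (T w) = herm v w" "\<forall>j. j \<notin> {} \<longrightarrow> T (e j) = e j"
      have "herm (T v) (e j) = herm v (e j)" for v j
        using T by (metis empty_iff)
      then have "T v = (\<Sum>i\<in>UNIV. (herm v (e i) / herm x x) *s e i)" for v
        using complete[of "T v"] by simp
      then have "T v = v" for v
        using complete[of v] by (rule trans[OF _ sym])
      then have "T = (\<lambda>v. v)"
        by (simp add: fun_eq_iff)
      then show "\<exists>N. loop_product x N T"
        using loop_product.zero by metis
    qed
  next
    case (insert k F)
    show ?case
    proof (intro allI impI)
      fix T :: "complex^'n \<Rightarrow> complex^'n"
      assume T: "\<forall>v w. herm (T v) (T w) = herm v w" "T x = x"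
        and fixed: "\<forall>j. j \<notin> insert k F \<longrightarrow> T (e j) = e j"
      define w where "w = e k - T (e k)"
      obtain \<nu> where \<nu>: "\<nu> * cnj \<nu> = 1" "creflect w \<nu> (T (e k)) = e k"
        using exists_creflect[of "T (e k)" "e k"] T(1) unfolding w_def by auto
      have "norm \<nu> = 1"
        by (rule power2_eq_imp_eq) (use \<nu>(1) in \<open>simp_all flip: complex_norm_square of_real_eq_1_iff[where 'a=complex]\<close>)
      \<comment> \<open>Since \<open>T\<close> is an isometry, all its fixed vectors are orthogonal
        to \<open>e k - T (e k)\<close>. The reflection that restores \<open>e k\<close> therefore
        disturbs neither \<open>x\<close> nor the basis vectors already in place.\<close>
      have perp: "herm y w = 0" if "T y = y" for y
        using T(1) that unfolding w_def by (metis herm.diff_right right_minus_eq)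
      have xw: "herm w x = 0"
        using perp[OF T(2)] by (metis cnj_herm complex_cnj_zero)
      define T' where "T' v = creflect w \<nu> (T v)" for v
      have "T' (e j) = e j" if "j \<notin> F" for j
        using that \<nu>(2) fixed perp by (cases "j = k") (auto simp: T'_def creflect_fixes)
      moreover have "T' x = x"
        by (simp add: T'_def T(2) creflect_fixes perp)
      moreover have "herm (T' v) (T' w) = herm v w" for v w
        by (simp add: T'_def herm_creflect[OF \<nu>(1)] T(1))
      ultimately obtain N where N: "loop_product x N T'"
        using insert.IH by blast
      obtain M where M: "loop_product x M (creflect w (cnj \<nu>))"
        using creflect[OF xw, of "cnj \<nu>"] \<open>norm \<nu> = 1\<close> by auto
      have "(\<lambda>v. creflect w (cnj \<nu>) (T' v)) = T"
        by (simp add: fun_eq_iff T'_def creflect_cnj_creflect[OF \<nu>(1)])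
      then show "\<exists>N. loop_product x N T"
        using loop_product_comp[OF M N] by metis
    qed
  qed
  from this[of UNIV] T show ?thesis
    by simp
qed

section \<open>The holonomy group\<close>

text \<open>The two real conditions are the real and the imaginary part of one condition on
  \<open>herm\<close>; the factor \<open>1 / |x|^2\<close> of the metric turns unit length into
  \<open>herm x x\<close>.\<close>

lemma unitary_basis_iff_herm:
  fixes x :: "complex^'n"
  assumes "x \<noteq> 0"
  shows "unitary_basis x e \<longleftrightarrow> (\<forall>i j. herm (e i) (e j) = (if i = j then herm x x else 0))"
proof -
  have "(hopf_metric x a b = r \<and> hopf_metric x a (hopf_J x b) = 0) \<longleftrightarrow> herm a b = of_real r * herm x x"
    for a b and r :: real
    using assms by (auto simp: hopf_metric_def hopf_J_def inner_eq_Re_herm herm_smult_right herm_self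
        complex_eq_iff field_simps)
  from this[of _ _ 1] this[of _ _ 0] show ?thesis
    unfolding unitary_basis_def by (simp split: if_split)
qed

theorem theorem5p12:
  fixes lam :: real and i0 :: "'n::finite" and m :: "(complex^'n) set"
  assumes "CARD('n) \<ge> 3" and "lam > 1" and "m \<in> hopf_manifold lam"
  shows "\<exists>x\<in>m. \<exists>e. unitary_basis x e \<and>
           hopf_holonomy lam m = frame_group lam m x e (unitary_block_subgroup i0)"
proof -
  from assms(3) obtain x where x: "x \<noteq> 0" and m: "m = hopf_proj lam x"
    by (auto simp: hopf_manifold_def)
  have "x \<in> m"
    by (auto simp: m hopf_proj_def intro!: exI[of _ 0])
  from exists_orthogonal_basis[OF x, of i0] obtain e where e0: "e i0 = x"
    and he': "\<forall>i j. herm (e i) (e j) = (if i = j then herm x x else 0)"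
    and complete': "\<forall>v. v = (\<Sum>i\<in>UNIV. (herm v (e i) / herm x x) *s e i)"
    by (elim exE conjE)
  note he = he'[rule_format] and complete = complete'[rule_format]
  define r where "r = herm x x"
  have r: "r \<noteq> 0" "cnj r = r"
    using x by (simp_all add: r_def)
  have coord: "herm (\<Sum>i\<in>UNIV. c i *s e i) (e j) = c j * r" for c j
    unfolding r_def by (rule herm_expansion[OF he])
  have sum_mult: "(\<Sum>i\<in>UNIV. (A *v a) $ i *s e i) = (\<Sum>j\<in>UNIV. a $ j *s (\<Sum>i\<in>UNIV. A $ i $ j *s e i))"
    for A and a :: "complex^'n"
  proof -
    have "(\<Sum>i\<in>UNIV. (A *v a) $ i *s e i) = (\<Sum>i\<in>UNIV. \<Sum>j\<in>UNIV. (a $ j * A $ i $ j) *s e i)"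
      by (simp add: smult.sum_left matrix_vector_mult_def mult.commute)
    also have "\<dots> = (\<Sum>j\<in>UNIV. \<Sum>i\<in>UNIV. (a $ j * A $ i $ j) *s e i)"
      by (rule sum.swap)
    finally show ?thesis
      by (simp add: smult.sum_right vector_smult_assoc)
  qed
  \<comment> \<open>The basis vectors have squared length \<open>r\<close>, hence the factor on the
    right.\<close>
  have parseval: "(\<Sum>l\<in>UNIV. herm v (e l) * cnj (herm w (e l))) = r * herm v w" for v w
  proof -
    have "herm v w = herm v (\<Sum>l\<in>UNIV. (herm w (e l) / r) *s e l)"
      using complete[of w] by (simp add: r_def)
    also have "\<dots> = (\<Sum>l\<in>UNIV. herm v (e l) * cnj (herm w (e l))) / r"
      by (simp add: herm.sum_right herm_smult_right r sum_divide_distrib mult.commute)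
    finally show ?thesis
      using r by simp
  qed
  have "hopf_holonomy lam m = frame_group lam m x e (unitary_block_subgroup i0)"
  proof (intro equalityI subsetI)
    fix P assume P: "P \<in> hopf_holonomy lam m"
    obtain T where T: "\<And>v. P (hopf_tproj lam x v) = hopf_tproj lam x (T v)"
      "\<And>v w. herm (T v) (T w) = herm v w" "T x = x"
      using hopf_holonomy_unitary[OF assms(2) x P[unfolded m]] by blast
    note lin = herm_isometry_linear[OF T(2)]
    have T0: "T 0 = 0"
      using lin(2)[of 0 0] by simp
    have T_sum: "T (\<Sum>j\<in>I. f j *s e j) = (\<Sum>j\<in>I. f j *s T (e j))" if "finite I" for f I
      using that by induction (simp_all add: T0 lin)
    define B where "B i j = herm (T (e j)) (e i) / r" for i j
    define A where "A = (\<chi> i j. if i = i0 \<and> j = i0 then 1 else if i = i0 \<or> j = i0 then 0 else B i j)"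
    \<comment> \<open>Column \<open>i0\<close> is that of the unit matrix because \<open>T\<close>
      fixes \<open>e i0 = x\<close>; row \<open>i0\<close> follows because \<open>T\<close> is also
      an isometry. So the full matrix \<open>B\<close> of \<open>T\<close> already has the block
      form \<open>A\<close>.\<close>
    have B1: "B i i0 = (if i = i0 then 1 else 0)" for i
      using he[of i0 i] r(1) by (auto simp: B_def e0 T(3) r_def)
    have B2: "B i0 j = (if j = i0 then 1 else 0)" for j
    proof -
      have "herm (T (e j)) (e i0) = herm (e j) (e i0)"
        using T(2)[of "e j" x] by (simp add: e0 T(3))
      then show ?thesis
        using r(1) by (simp add: B_def he flip: r_def)
    qed
    have AB: "A $ i $ j = B i j" for i j
      by (simp add: A_def B1 B2)
    have unitary: "(\<Sum>l\<in>UNIV. cnj (B l j) * B l k) = (if j = k then 1 else 0)" for j k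
    proof -
      have "(\<Sum>l\<in>UNIV. cnj (B l j) * B l k)
          = (\<Sum>l\<in>UNIV. herm (T (e k)) (e l) * cnj (herm (T (e j)) (e l))) / (r * r)"
        by (simp add: B_def r sum_divide_distrib mult.commute)
      also have "\<dots> = (if j = k then 1 else 0)"
        using r by (simp add: parseval T(2) he flip: r_def)
      finally show ?thesis .
    qed
    have "unitary_matrix_on (- {i0}) B"
      unfolding unitary_matrix_on_def
    proof (intro ballI)
      fix j k assume "j \<in> - {i0}" "k \<in> - {i0}"
      then show "(\<Sum>l\<in>- {i0}. cnj (B l j) * B l k) = (if j = k then 1 else 0)"
        using unitary[of j k] sum.remove[of UNIV i0 "\<lambda>l. cnj (B l j) * B l k"]
        by (simp add: B2 Compl_eq_Diff_UNIV)
    qed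
    then have "A \<in> unitary_block_subgroup i0"
      unfolding unitary_block_subgroup_def A_def by blast
    moreover have "P (frame_map lam x e a) = frame_map lam x e (A *v a)" for a
    proof -
      have "T (e j) = (\<Sum>i\<in>UNIV. A $ i $ j *s e i)" for j
        using complete[of "T (e j)"] by (simp add: AB B_def r_def)
      then show ?thesis
        by (simp add: frame_map_def T(1) T_sum sum_mult)
    qed
    ultimately show "P \<in> frame_group lam m x e (unitary_block_subgroup i0)"
      using P by (auto simp: frame_group_def hopf_holonomy_def)
  next
    fix P assume "P \<in> frame_group lam m x e (unitary_block_subgroup i0)"
    then obtain A where P: "P \<in> hopf_tangent lam m \<rightarrow>\<^sub>E hopf_tangent lam m"
      and A: "A \<in> unitary_block_subgroup i0"
      and PA: "\<And>a. P (frame_map lam x e a) = frame_map lam x e (A *v a)"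
      by (auto simp: frame_group_def)
    obtain B where A_def: "A = (\<chi> i j. if i = i0 \<and> j = i0 then 1 else if i = i0 \<or> j = i0 then 0 else B i j)"
      and B: "unitary_matrix_on (- {i0}) B"
      using A by (auto simp: unitary_block_subgroup_def)
    have unitary: "(\<Sum>l\<in>UNIV. A $ l $ j * cnj (A $ l $ k)) = (if j = k then 1 else 0)" for j k
    proof -
      have "(\<Sum>l\<in>UNIV. A $ l $ j * cnj (A $ l $ k)) = A $ i0 $ j * cnj (A $ i0 $ k)
          + (\<Sum>l\<in>- {i0}. A $ l $ j * cnj (A $ l $ k))"
        by (subst sum.remove[of UNIV i0]) (simp_all add: Compl_eq_Diff_UNIV)
      also have "\<dots> = (if j = k then 1 else 0)"
      proof (cases "j = i0 \<or> k = i0")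
        case True
        then have "(\<Sum>l\<in>- {i0}. A $ l $ j * cnj (A $ l $ k)) = 0"
          by (intro sum.neutral) (auto simp: A_def)
        then show ?thesis
          using True by (auto simp: A_def)
      next
        case False
        then have "(\<Sum>l\<in>- {i0}. A $ l $ j * cnj (A $ l $ k)) = (\<Sum>l\<in>- {i0}. cnj (B l k) * B l j)"
          by (intro sum.cong) (auto simp: A_def)
        then show ?thesis
          using False B by (auto simp: A_def unitary_matrix_on_def)
      qed
      finally show ?thesis .
    qed
    define c where "c v = (\<chi> j. herm v (e j) / r)" for v
    define T where "T v = (\<Sum>i\<in>UNIV. (A *v c v) $ i *s e i)" for v
    have PT: "P (hopf_tproj lam x v) = hopf_tproj lam x (T v)" for v
    proof -
      have "frame_map lam x e (c v) = hopf_tproj lam x v"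
        using complete[of v] by (simp add: frame_map_def c_def r_def)
      then show ?thesis
        using PA[of "c v"] by (simp add: frame_map_def T_def)
    qed
    have "herm (T v) (T w) = herm v w" for v w
    proof -
      let ?f = "\<lambda>j. \<Sum>i\<in>UNIV. A $ i $ j *s e i"
      have "herm (?f j) (?f k) = (if j = k then r else 0)" for j k
      proof -
        have "herm (?f j) (?f k) = r * (\<Sum>l\<in>UNIV. A $ l $ j * cnj (A $ l $ k))"
          unfolding herm.sum_right herm_smult_right coord by (simp add: sum_distrib_left mult_ac)
        then show ?thesis
          by (simp add: unitary)
      qed
      then have coord': "herm (\<Sum>j\<in>UNIV. d j *s ?f j) (?f k) = d k * r" for d k
        by (rule herm_expansion)
      have "herm (T v) (T w) = (\<Sum>k\<in>UNIV. (c v $ k * r) * cnj (c w $ k))"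
        unfolding T_def sum_mult herm.sum_right[of _ "\<lambda>k. c w $ k *s ?f k"] herm_smult_right coord'
        by (simp add: mult.commute)
      also have "\<dots> = (\<Sum>k\<in>UNIV. herm v (e k) * cnj (herm w (e k))) / r"
        using r by (simp add: c_def sum_divide_distrib)
      also have "\<dots> = herm v w"
        using r by (simp add: parseval)
      finally show ?thesis .
    qed
    moreover have "T x = x"
    proof -
      have "c x $ j = (if j = i0 then 1 else 0)" for j
        using he[of i0 j] r by (auto simp: c_def e0 r_def)
      then have "T x = (\<Sum>i\<in>UNIV. A $ i $ i0 *s e i)"
        unfolding T_def sum_mult by (simp add: if_distrib[of "\<lambda>z. z *s _"] cong: if_cong)
      also have "\<dots> = x"
        by (simp add: A_def e0 if_distrib[of "\<lambda>z. z *s _"] cong: if_cong)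
      finally show ?thesis .
    qed
    ultimately obtain N where N: "loop_product x N T"
      using loop_product_isometry[OF assms(1) x e0 he complete] by blast
    \<comment> \<open>The product may consist of \<open>N = 0\<close> circles, but a subdivision of
      \<open>{0..1}\<close> has at least one piece. A circle with phase 1, which acts as the
      identity, is appended; its direction is a basis vector other than \<open>x\<close>.\<close>
    have "\<exists>i. i \<noteq> i0"
    proof (rule ccontr)
      assume "\<nexists>i. i \<noteq> i0"
      then have "CARD('n) = card {i0}"
        by (intro arg_cong[of _ _ card]) auto
      with assms(1) show False
        by simp
    qed
    then obtain i where "i \<noteq> i0"
      by blast
    then have "herm (e i) x = 0" "herm (e i) (e i) = herm x x"
      using he[of i i0] he[of i i] by (simp_all add: e0)
    from loop_product.Suc[OF N this, of 1] have "loop_product x (Suc N) T"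
      by (simp add: loop_map_def)
    from hopf_holonomyI_loop_product[OF assms(2) x this _ P[unfolded m] PT]
    show "P \<in> hopf_holonomy lam m"
      by (simp add: m)
  qed
  moreover have "unitary_basis x e"
    using he by (simp add: unitary_basis_iff_herm[OF x])
  ultimately show ?thesis
    using \<open>x \<in> m\<close> by blast
qed

end
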